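(* Let $(M,\Delta,g)$ be a complete contact sub-Riemannian manifold, with $\Delta$ of rank $k=2d$, admitting a global orthonormal frame of $\Delta$. Let $\omega=e^h\mathcal{P}$ with $\mathcal{P}$ the Popp volume and $h\in C^\infty(M)$, and let $c\in[0,1]$. For a global orthonormal frame $X_1,\dots,X_k$ of $\Delta$ consider the operator $$L_{\omega,c}=\Delta_\omega+c\,\mathrm{grad}(h)+(c-1)\sum_{i=1}^k\mathrm{div}_\omega(X_i)X_i$$ (the limit operator of the flow random walk with volume sampling). The operator $L_{\omega,c}$ does not depend on the choice of the orthonormal frame if and only if $c=1$. In this case $$L_{\omega,1}=\Delta_\omega+\mathrm{grad}(h)=\Delta_{e^h\omega}=\Delta_{e^{2h}\mathcal{P}}.$$
   Context: Contact sub-Riemannian structure: $M$ is a connected smooth manifold of dimension $2d+1$, $d\ge1$; $\Delta\subset TM$ is a rank $2d$ distribution with smooth scalar product $g$, such that $\Delta=\ker\eta$ for a global one-form $\eta$; the skew-symmetric contact endomorphism $J:\Delta\to\Delta$, defined by $g(X,JY)=d\eta(X,Y)$ for $X,Y\in\Gamma(\Delta)$, is non-degenerate; $\eta$ is normalized (up to sign) by $\mathrm{Tr}(JJ^* )=1$. The Reeb field $X_0$ is the unique vector field with $\eta(X_0)=1$, $\iota_{X_0}d\eta=0$. The Popp density $\mathcal{P}$ is the unique density with $\mathcal{P}(X_0,X_1,\dots,X_{2d})=1$ for any orthonormal frame $X_1,\dots,X_{2d}$ of $\Delta$. Complete means complete for the sub-Riemannian distance. $\mathrm{grad}(\phi)=\sum_{i=1}^kX_i(\phi)X_i$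 is the horizontal gradient (independent of the orthonormal frame), $\mathrm{div}_\omega(X)$ is defined by $\mathcal{L}_X\omega=\mathrm{div}_\omega(X)\,\omega$, $\Delta_\omega=\mathrm{div}_\omega\circ\mathrm{grad}$ for any volume $\omega$, and $\mathrm{grad}(h)$ is understood as a derivation. *)

theory Defs
  imports "HOL-Analysis.Analysis"
begin

section \<open>Smooth manifolds\<close>

primrec Ck_on :: "nat \<Rightarrow> ('a::real_normed_vector) set \<Rightarrow> ('a \<Rightarrow> 'b::real_normed_vector) \<Rightarrow> bool" where
  "Ck_on 0 S f \<longleftrightarrow> continuous_on S f"
| "Ck_on (Suc n) S f \<longleftrightarrow> (\<forall>x\<in>S. f differentiable (at x)) \<and>
     (\<forall>v. Ck_on n S (\<lambda>x. frechet_derivative f (at x) v))"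

text \<open>Only used on open sets.\<close>
definition Cinf_on :: "('a::real_normed_vector) set \<Rightarrow> ('a \<Rightarrow> 'b::real_normed_vector) \<Rightarrow> bool" where
  "Cinf_on S f \<longleftrightarrow> (\<forall>n. Ck_on n S f)"

type_synonym ('m, 'n) chart = "'m set \<times> ('m \<Rightarrow> real ^ 'n)"

text \<open>The manifold is the whole type; its dimension is the cardinality of the index type
  \<open>'n\<close>. The atlas need not be maximal.\<close>
definition smooth_manifold :: "('m::{t2_space,second_countable_topology}, 'n::finite) chart set \<Rightarrow> bool" where
  "smooth_manifold A \<longleftrightarrow>
     (\<Union>(U, \<phi>)\<in>A. U) = UNIV \<and>
     (\<forall>(U, \<phi>)\<in>A. open U \<and> open (\<phi> ` U) \<and> homeomorphism U (\<phi> ` U) \<phi> (inv_into U \<phi>)) \<and>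
     (\<forall>(U, \<phi>)\<in>A. \<forall>(V, \<psi>)\<in>A. Cinf_on (\<phi> ` (U \<inter> V)) (\<psi> \<circ> inv_into U \<phi>))"

definition smooth_fun_on ::
    "('m::topological_space, 'n::finite) chart set \<Rightarrow> 'm set \<Rightarrow> ('m \<Rightarrow> real) \<Rightarrow> bool" where
  "smooth_fun_on A W f \<longleftrightarrow> (\<forall>(U, \<phi>)\<in>A. Cinf_on (\<phi> ` (U \<inter> W)) (f \<circ> inv_into U \<phi>))"

definition smooth_near ::
    "('m::topological_space, 'n::finite) chart set \<Rightarrow> 'm \<Rightarrow> ('m \<Rightarrow> real) \<Rightarrow> bool" where
  "smooth_near A p f \<longleftrightarrow> (\<exists>W. open W \<and> p \<in> W \<and> smooth_fun_on A W f)"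


section \<open>Tangent vectors and vector fields\<close>

text \<open>A tangent vector at \<open>p\<close> is a derivation of the algebra of functions that are smooth near
  \<open>p\<close>. It is made extensional (value 0 on all other functions), so that equality of tangent
  vectors is equality of functions. Applying the Leibniz rule to a function that is constant near
  \<open>p\<close> shows that such a derivation only depends on the germ at \<open>p\<close>.\<close>

type_synonym 'm tvec = "('m \<Rightarrow> real) \<Rightarrow> real"

definition tangent_space :: "('m::topological_space, 'n::finite) chart set \<Rightarrow> 'm \<Rightarrow> 'm tvec set" where
  "tangent_space A p = {v.
     (\<forall>f g a b. smooth_near A p f \<longrightarrow> smooth_near A p g \<longrightarrow>
        v (\<lambda>q. a * f q + b * g q) = a * v f + b * v g) \<and>
     (\<forall>f g. smooth_near A p f \<longrightarrow> smooth_near A p g \<longrightarrow>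
        v (\<lambda>q. f q * g q) = v f * g p + f p * v g) \<and>
     (\<forall>f. \<not> smooth_near A p f \<longrightarrow> v f = 0)}"

definition lincomb :: "('i::finite \<Rightarrow> real) \<Rightarrow> ('i \<Rightarrow> 'm tvec) \<Rightarrow> 'm tvec" where
  "lincomb a v = (\<lambda>f. \<Sum>i\<in>UNIV. a i * v i f)"

definition is_basis :: "'m tvec set \<Rightarrow> ('i::finite \<Rightarrow> 'm tvec) \<Rightarrow> bool" where
  "is_basis V v \<longleftrightarrow> (\<forall>i. v i \<in> V) \<and> (\<forall>w\<in>V. \<exists>!a. w = lincomb a v)"

definition coords :: "('i::finite \<Rightarrow> 'm tvec) \<Rightarrow> 'm tvec \<Rightarrow> 'i \<Rightarrow> real" where
  "coords v w = (THE a. w = lincomb a v)"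

text \<open>Trace of the matrix of the endomorphism \<open>T\<close> in the basis \<open>v\<close>.\<close>
definition basis_trace :: "('i::finite \<Rightarrow> 'm tvec) \<Rightarrow> ('m tvec \<Rightarrow> 'm tvec) \<Rightarrow> real" where
  "basis_trace v T = (\<Sum>i\<in>UNIV. coords v (T (v i)) i)"

definition adjoint_on ::
    "'m tvec set \<Rightarrow> ('m tvec \<Rightarrow> 'm tvec \<Rightarrow> real) \<Rightarrow> ('m tvec \<Rightarrow> 'm tvec) \<Rightarrow> 'm tvec \<Rightarrow> 'm tvec" where
  "adjoint_on V b T v = (THE w. w \<in> V \<and> (\<forall>u\<in>V. b u w = b (T u) v))"

type_synonym 'm vfield = "'m \<Rightarrow> 'm tvec"

definition vfield_on ::
    "('m::topological_space, 'n::finite) chart set \<Rightarrow> 'm set \<Rightarrow> 'm vfield \<Rightarrow> bool" where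
  "vfield_on A U X \<longleftrightarrow> (\<forall>p\<in>U. X p \<in> tangent_space A p) \<and>
     (\<forall>V f. open V \<longrightarrow> V \<subseteq> U \<longrightarrow> smooth_fun_on A V f \<longrightarrow> smooth_fun_on A V (\<lambda>p. X p f))"

definition bracket ::
    "('m::topological_space, 'n::finite) chart set \<Rightarrow> 'm vfield \<Rightarrow> 'm vfield \<Rightarrow> 'm vfield" where
  "bracket A X Y = (\<lambda>p f. if smooth_near A p f
     then X p (\<lambda>q. Y q f) - Y p (\<lambda>q. X q f) else 0)"

type_synonym 'm oneform = "'m \<Rightarrow> 'm tvec \<Rightarrow> real"

definition is_oneform :: "('m::topological_space, 'n::finite) chart set \<Rightarrow> 'm oneform \<Rightarrow> bool" where
  "is_oneform A \<alpha> \<longleftrightarrow>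
     (\<forall>p. \<forall>v\<in>tangent_space A p. \<forall>w\<in>tangent_space A p. \<forall>a b.
        \<alpha> p (\<lambda>f. a * v f + b * w f) = a * \<alpha> p v + b * \<alpha> p w) \<and>
     (\<forall>U X. open U \<longrightarrow> vfield_on A U X \<longrightarrow> smooth_fun_on A U (\<lambda>p. \<alpha> p (X p)))"

text \<open>Exterior derivative of a one-form, evaluated on two vector fields at a point, with the
  normalization without a factor 1/2.\<close>
definition ext_deriv :: "('m::topological_space, 'n::finite) chart set \<Rightarrow> 'm oneform \<Rightarrow>
    'm vfield \<Rightarrow> 'm vfield \<Rightarrow> 'm \<Rightarrow> real" where
  "ext_deriv A \<alpha> X Y p =
     X p (\<lambda>q. \<alpha> q (Y q)) - Y p (\<lambda>q. \<alpha> q (X q)) - \<alpha> p (bracket A X Y p)"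


section \<open>Densities and divergence\<close>

type_synonym ('m, 'n) density = "'m \<Rightarrow> ('n \<Rightarrow> 'm tvec) \<Rightarrow> real"

definition frame_on ::
    "('m::topological_space, 'n::finite) chart set \<Rightarrow> 'm set \<Rightarrow> ('n \<Rightarrow> 'm vfield) \<Rightarrow> bool" where
  "frame_on A U Y \<longleftrightarrow> (\<forall>i. vfield_on A U (Y i)) \<and>
     (\<forall>p\<in>U. is_basis (tangent_space A p) (\<lambda>i. Y i p))"

definition is_density ::
    "('m::topological_space, 'n::finite) chart set \<Rightarrow> ('m, 'n) density \<Rightarrow> bool" where
  "is_density A \<omega> \<longleftrightarrow>
     (\<forall>p v. \<forall>B::real^'n^'n. (\<forall>i. v i \<in> tangent_space A p) \<longrightarrow>
        \<omega> p (\<lambda>i. lincomb (\<lambda>j. B $ i $ j) v) = \<bar>det B\<bar> * \<omega> p v) \<and>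
     (\<forall>p v. is_basis (tangent_space A p) v \<longrightarrow> \<omega> p v > 0) \<and>
     (\<forall>U Y. open U \<longrightarrow> frame_on A U Y \<longrightarrow> smooth_fun_on A U (\<lambda>p. \<omega> p (\<lambda>i. Y i p)))"

definition scale_density :: "('m \<Rightarrow> real) \<Rightarrow> ('m, 'n) density \<Rightarrow> ('m, 'n) density" where
  "scale_density u \<omega> = (\<lambda>p v. u p * \<omega> p v)"

text \<open>The value at \<open>p\<close> of the Lie derivative of the density \<open>\<omega>\<close> along \<open>X\<close> on a local frame
  \<open>Y\<close> near \<open>p\<close>, given by the Leibniz rule. For a volume form this is the usual
  \<open>X(\<omega>(Y\<^sub>1,\<dots>,Y\<^sub>n)) - (\<Sum>i. \<omega>(Y\<^sub>1,\<dots>,[X,Y\<^sub>i],\<dots>,Y\<^sub>n))\<close>. Densities are not multilinear, so the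
  sum is replaced by the expression it computes, the derivative of \<open>\<omega>\<close> at \<open>(Y\<^sub>1,\<dots>,Y\<^sub>n)\<close> in
  direction \<open>([X,Y\<^sub>1],\<dots>,[X,Y\<^sub>n])\<close>.\<close>
definition lie_deriv_density :: "('m::topological_space, 'n::finite) chart set \<Rightarrow> 'm vfield \<Rightarrow>
    ('m, 'n) density \<Rightarrow> ('n \<Rightarrow> 'm vfield) \<Rightarrow> 'm \<Rightarrow> real" where
  "lie_deriv_density A X \<omega> Y p =
     X p (\<lambda>q. \<omega> q (\<lambda>i. Y i q)) -
     deriv (\<lambda>s. \<omega> p (\<lambda>i f. Y i p f + s * bracket A X (Y i) p f)) 0"

definition divergence :: "('m::topological_space, 'n::finite) chart set \<Rightarrow> ('m, 'n) density \<Rightarrow>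
    'm vfield \<Rightarrow> 'm \<Rightarrow> real" where
  "divergence A \<omega> X p = (THE r. \<forall>U Y. open U \<longrightarrow> p \<in> U \<longrightarrow> frame_on A U Y \<longrightarrow>
     lie_deriv_density A X \<omega> Y p = r * \<omega> p (\<lambda>i. Y i p))"


section \<open>Contact sub-Riemannian structures\<close>

text \<open>The rank of the distribution is the cardinality of \<open>'k\<close>, and the manifold has dimension
  \<open>CARD('k option) = CARD('k) + 1\<close>. In a frame of the tangent bundle indexed by \<open>'k option\<close>,
  index \<open>None\<close> is reserved for the Reeb field.\<close>
record ('m, 'k) subriem =
  charts :: "('m, 'k option) chart set"
  hdistr :: "'m \<Rightarrow> 'm tvec set"
  hmetric :: "'m \<Rightarrow> 'm tvec \<Rightarrow> 'm tvec \<Rightarrow> real"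
  cform :: "'m oneform"

definition section_on :: "('m::topological_space, 'k::finite) subriem \<Rightarrow> 'm set \<Rightarrow> 'm vfield \<Rightarrow> bool" where
  "section_on S U X \<longleftrightarrow> vfield_on (charts S) U X \<and> (\<forall>p\<in>U. X p \<in> hdistr S p)"

definition smooth_distribution :: "('m::topological_space, 'k::finite) subriem \<Rightarrow> bool" where
  "smooth_distribution S \<longleftrightarrow>
     (\<forall>p. hdistr S p \<subseteq> tangent_space (charts S) p) \<and>
     (\<forall>p. \<exists>U. \<exists>Y::'k \<Rightarrow> 'm vfield. open U \<and> p \<in> U \<and> (\<forall>i. section_on S U (Y i)) \<and>
        (\<forall>q\<in>U. is_basis (hdistr S q) (\<lambda>i. Y i q)))"

definition smooth_scalar_product :: "('m::topological_space, 'k::finite) subriem \<Rightarrow> bool" where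
  "smooth_scalar_product S \<longleftrightarrow>
     (\<forall>p. \<forall>u\<in>hdistr S p. \<forall>v\<in>hdistr S p. \<forall>w\<in>hdistr S p. \<forall>a b.
        hmetric S p (\<lambda>f. a * u f + b * v f) w = a * hmetric S p u w + b * hmetric S p v w) \<and>
     (\<forall>p. \<forall>u\<in>hdistr S p. \<forall>v\<in>hdistr S p. hmetric S p u v = hmetric S p v u) \<and>
     (\<forall>p. \<forall>v\<in>hdistr S p. v \<noteq> (\<lambda>f. 0) \<longrightarrow> hmetric S p v v > 0) \<and>
     (\<forall>U X Y. open U \<longrightarrow> section_on S U X \<longrightarrow> section_on S U Y \<longrightarrow>
        smooth_fun_on (charts S) U (\<lambda>p. hmetric S p (X p) (Y p)))"

definition contact_endo :: "('m::topological_space, 'k::finite) subriem \<Rightarrow> 'm \<Rightarrow> 'm tvec \<Rightarrow> 'm tvec" where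
  "contact_endo S p v = (THE w. w \<in> hdistr S p \<and>
     (\<forall>U X Y. open U \<longrightarrow> p \<in> U \<longrightarrow> section_on S U X \<longrightarrow> section_on S U Y \<longrightarrow> Y p = v \<longrightarrow>
        hmetric S p (X p) w = ext_deriv (charts S) (cform S) X Y p))"

text \<open>The last condition is the normalization \<open>Tr (J J\<^sup>*) = 1\<close>; the trace of an endomorphism may be
  computed in any basis.\<close>
definition contact_subriemannian ::
    "('m::{t2_space,second_countable_topology}, 'k::finite) subriem \<Rightarrow> bool" where
  "contact_subriemannian S \<longleftrightarrow>
     smooth_manifold (charts S) \<and> connected (UNIV :: 'm set) \<and>
     smooth_distribution S \<and> smooth_scalar_product S \<and>
     is_oneform (charts S) (cform S) \<and>
     (\<forall>p. hdistr S p = {v \<in> tangent_space (charts S) p. cform S p v = 0}) \<and>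
     (\<forall>p. \<forall>v\<in>hdistr S p. contact_endo S p v = (\<lambda>f. 0) \<longrightarrow> v = (\<lambda>f. 0)) \<and>
     (\<forall>p. \<forall>v::'k \<Rightarrow> 'm tvec. is_basis (hdistr S p) v \<longrightarrow>
        basis_trace v (contact_endo S p \<circ> adjoint_on (hdistr S p) (hmetric S p) (contact_endo S p)) = 1)"

definition reeb_field :: "('m::topological_space, 'k::finite) subriem \<Rightarrow> 'm vfield \<Rightarrow> bool" where
  "reeb_field S X0 \<longleftrightarrow> vfield_on (charts S) UNIV X0 \<and> (\<forall>p. cform S p (X0 p) = 1) \<and>
     (\<forall>U Y. open U \<longrightarrow> vfield_on (charts S) U Y \<longrightarrow>
        (\<forall>p\<in>U. ext_deriv (charts S) (cform S) X0 Y p = 0))"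

definition orthonormal_basis ::
    "('m::topological_space, 'k::finite) subriem \<Rightarrow> 'm \<Rightarrow> ('k \<Rightarrow> 'm tvec) \<Rightarrow> bool" where
  "orthonormal_basis S p e \<longleftrightarrow> is_basis (hdistr S p) e \<and>
     (\<forall>i j. hmetric S p (e i) (e j) = (if i = j then 1 else 0))"

definition orthonormal_frame ::
    "('m::topological_space, 'k::finite) subriem \<Rightarrow> ('k \<Rightarrow> 'm vfield) \<Rightarrow> bool" where
  "orthonormal_frame S X \<longleftrightarrow> (\<forall>i. section_on S UNIV (X i)) \<and>
     (\<forall>p. orthonormal_basis S p (\<lambda>i. X i p))"

definition popp_density :: "('m::topological_space, 'k::finite) subriem \<Rightarrow> 'm vfield \<Rightarrow>
    ('m, 'k option) density \<Rightarrow> bool" where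
  "popp_density S X0 P \<longleftrightarrow> is_density (charts S) P \<and>
     (\<forall>p e. orthonormal_basis S p e \<longrightarrow> P p (case_option (X0 p) e) = 1)"


section \<open>Sub-Riemannian distance and completeness\<close>

definition velocity :: "('m::topological_space, 'n::finite) chart set \<Rightarrow> (real \<Rightarrow> 'm) \<Rightarrow> real \<Rightarrow> 'm tvec" where
  "velocity A \<gamma> t = (\<lambda>f. if smooth_near A (\<gamma> t) f then deriv (f \<circ> \<gamma>) t else 0)"

definition lipschitz_curve :: "('m::topological_space, 'n::finite) chart set \<Rightarrow> (real \<Rightarrow> 'm) \<Rightarrow> bool" where
  "lipschitz_curve A \<gamma> \<longleftrightarrow> (\<forall>t\<in>{0..1}. \<exists>(U, \<phi>)\<in>A. \<exists>\<epsilon>>0. \<exists>C.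
     \<gamma> ` ({t-\<epsilon>..t+\<epsilon>} \<inter> {0..1}) \<subseteq> U \<and> C-lipschitz_on ({t-\<epsilon>..t+\<epsilon>} \<inter> {0..1}) (\<phi> \<circ> \<gamma>))"

text \<open>A Lipschitz curve is differentiable almost everywhere, so the exceptional null set absorbs
  the points where \<^term>\<open>velocity\<close> is meaningless.\<close>
definition horizontal_curve :: "('m::topological_space, 'k::finite) subriem \<Rightarrow> (real \<Rightarrow> 'm) \<Rightarrow> bool" where
  "horizontal_curve S \<gamma> \<longleftrightarrow> lipschitz_curve (charts S) \<gamma> \<and>
     (\<exists>N. negligible N \<and> (\<forall>t\<in>{0..1} - N. velocity (charts S) \<gamma> t \<in> hdistr S (\<gamma> t)))"

definition curve_length :: "('m::topological_space, 'k::finite) subriem \<Rightarrow> (real \<Rightarrow> 'm) \<Rightarrow> real" where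
  "curve_length S \<gamma> = integral {0..1}
     (\<lambda>t. sqrt (hmetric S (\<gamma> t) (velocity (charts S) \<gamma> t) (velocity (charts S) \<gamma> t)))"

definition sr_dist :: "('m::topological_space, 'k::finite) subriem \<Rightarrow> 'm \<Rightarrow> 'm \<Rightarrow> ereal" where
  "sr_dist S x y = (INF \<gamma>\<in>{\<gamma>. horizontal_curve S \<gamma> \<and> \<gamma> 0 = x \<and> \<gamma> 1 = y}. ereal (curve_length S \<gamma>))"

definition sr_complete :: "('m::topological_space, 'k::finite) subriem \<Rightarrow> bool" where
  "sr_complete S \<longleftrightarrow> (\<forall>s::nat \<Rightarrow> 'm.
     (\<forall>\<epsilon>>0. \<exists>N. \<forall>m\<ge>N. \<forall>n\<ge>N. sr_dist S (s m) (s n) < ereal \<epsilon>) \<longrightarrow>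
     (\<exists>x. (\<lambda>n. sr_dist S (s n) x) \<longlonglongrightarrow> 0))"


section \<open>Gradient, sub-Laplacian and limit operator\<close>

definition hgrad :: "('m::topological_space, 'k::finite) subriem \<Rightarrow> ('m \<Rightarrow> real) \<Rightarrow> 'm vfield" where
  "hgrad S u p = (THE w. \<forall>e. orthonormal_basis S p e \<longrightarrow> w = lincomb (\<lambda>i. e i u) e)"

definition sublaplacian :: "('m::topological_space, 'k::finite) subriem \<Rightarrow> ('m, 'k option) density \<Rightarrow>
    ('m \<Rightarrow> real) \<Rightarrow> 'm \<Rightarrow> real" where
  "sublaplacian S \<omega> u = divergence (charts S) \<omega> (hgrad S u)"

definition limit_operator :: "('m::topological_space, 'k::finite) subriem \<Rightarrow> ('m, 'k option) density \<Rightarrow>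
    ('m \<Rightarrow> real) \<Rightarrow> real \<Rightarrow> ('k \<Rightarrow> 'm vfield) \<Rightarrow> ('m \<Rightarrow> real) \<Rightarrow> 'm \<Rightarrow> real" where
  "limit_operator S \<omega> h c X u p =
     sublaplacian S \<omega> u p + c * hgrad S h p u +
     (c - 1) * (\<Sum>i\<in>UNIV. divergence (charts S) \<omega> (X i) p * X i p u)"

end

theory Submission
  imports Defs
begin

text \<open>The divergence of a density is computed in a local frame \<open>Y\<close> and functions \<open>f\<close> with \<open>Y\<^sub>i(f\<^sub>j) = \<delta>\<^sub>i\<^sub>j\<close>
  at \<open>p\<close> as \<open>X(\<omega>(Y))/\<omega>(Y) - (\<Sum>i. [X,Y\<^sub>i](f\<^sub>i))\<close>. This gives \<open>div(aX) = a div(X) + X(a)\<close> and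
  \<open>div\<close> of \<open>e\<^sup>h\<omega>\<close> equal to \<open>div\<close> of \<open>\<omega>\<close> plus \<open>X(h)\<close>, hence the formula for the operator with \<open>c = 1\<close>.
  For \<open>c \<noteq> 1\<close>, rotating two fields of the frame by a non-constant angle changes the first order term
  \<open>\<Sum>i. div(X\<^sub>i)X\<^sub>i\<close>; the rotation has to be defined on all of \<open>M\<close>, which is where bump functions enter.
  Only the algebra of derivations is used, never the coordinate description of tangent vectors.\<close>

section \<open>Functions of class \<open>C\<^sup>k\<close>\<close>

text \<open>\<open>divergence\<close> and \<open>hgrad\<close> are definite descriptions, so neither
  can be computed before independence of the frame is proved; for the divergence this is the main
  obstacle. Tangent vectors are bare derivations, so coordinates are replaced by functions dual to a
  basis, which linear algebra supplies. A chain rule is replaced by the Leibniz rule in the two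
  places that would call for one: the exponential is factored as exp x = 1 + x g(x), and the circle
  is parametrised rationally by t = tan(angle/2), so that products and an inverse stand in for sine
  and cosine. The drift sum of div(X_i) X_i detects a rotation for this reason: in div(aX) = a
  div(X) + X(a) the first terms rotate along with the fields and cancel, and the derivatives of the
  rotation remain. The other terms of the operator do not mention the frame, so two frames whose
  drifts differ at a single point force c = 1.\<close>

lemma Ck_on_subset: "Ck_on n T f \<Longrightarrow> S \<subseteq> T \<Longrightarrow> Ck_on n S f"
  by (induction n arbitrary: f) (auto intro: continuous_on_subset)

lemma Ck_on_cong:
  assumes "open S" "\<And>x. x \<in> S \<Longrightarrow> f x = g x" "Ck_on n S f"
  shows "Ck_on n S g"
  using assms(2,3)
proof (induction n arbitrary: f g)
  case 0
  then show ?case using continuous_on_cong[of S S f g] by auto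
next
  case (Suc n)
  have fr: "frechet_derivative f (at x) = frechet_derivative g (at x)" if "x \<in> S" for x
    using that Suc.prems(2)
    by (intro frechet_derivative_transform_within_open[OF _ \<open>open S\<close> that Suc.prems(1)]) auto
  have "g differentiable (at x)" if "x \<in> S" for x
    using that Suc.prems \<open>open S\<close>
    by (meson Ck_on.simps(2) differentiable_def has_derivative_transform_within_open)
  moreover have "Ck_on n S (\<lambda>x. frechet_derivative g (at x) v)" for v
  proof (rule Suc.IH)
    show "Ck_on n S (\<lambda>x. frechet_derivative f (at x) v)" using Suc.prems(2) by simp
    show "frechet_derivative f (at x) v = frechet_derivative g (at x) v" if "x \<in> S" for x
      using fr[OF that] by simp
  qed
  ultimately show ?case unfolding Ck_on.simps(2) by blast
qed

text \<open>The closure rules below rest on this: a derivative given by a formula replaces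
  \<open>frechet_derivative\<close>, with which it agrees on S only, and \<open>Ck_on_cong\<close>
  carries the regularity over.\<close>

lemma Ck_on_SucI:
  assumes "open S" "\<And>x. x \<in> S \<Longrightarrow> (f has_derivative D x) (at x)"
    and "\<And>v. Ck_on n S (\<lambda>x. D x v)"
  shows "Ck_on (Suc n) S f"
proof -
  have "Ck_on n S (\<lambda>x. frechet_derivative f (at x) v)" for v
    by (rule Ck_on_cong[OF assms(1) _ assms(3)[of v]])
      (simp add: frechet_derivative_at[OF assms(2), symmetric])
  then show ?thesis using assms(2) by (auto simp: differentiable_def)
qed

lemma Ck_on_Suc_has_derivative:
  "Ck_on (Suc n) S f \<Longrightarrow> x \<in> S \<Longrightarrow> (f has_derivative frechet_derivative f (at x)) (at x)"
  by (auto simp: frechet_derivative_works[symmetric])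

lemma Ck_on_SucD: "Ck_on (Suc n) S f \<Longrightarrow> Ck_on n S f"
proof (induction n arbitrary: f)
  case 0
  then show ?case
    by (auto intro!: continuous_at_imp_continuous_on differentiable_imp_continuous_within)
next
  case (Suc n)
  then have "\<forall>x\<in>S. f differentiable (at x)"
    and "Ck_on (Suc n) S (\<lambda>x. frechet_derivative f (at x) v)" for v
    unfolding Ck_on.simps(2)[of "Suc n"] by blast+
  with Suc.IH show ?case unfolding Ck_on.simps(2)[of n] by blast
qed

lemma Ck_on_local:
  assumes "\<And>x. x \<in> S \<Longrightarrow> \<exists>T. open T \<and> x \<in> T \<and> Ck_on n T f"
  shows "Ck_on n S f"
  using assms
proof (induction n arbitrary: f)
  case 0
  have "isCont f x" if "x \<in> S" for x
    using 0[OF that] by (auto simp: continuous_on_eq_continuous_at)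
  then show ?case by (auto intro: continuous_at_imp_continuous_on)
next
  case (Suc n)
  have "Ck_on n S (\<lambda>x. frechet_derivative f (at x) v)" for v
    using Suc.prems by (intro Suc.IH) fastforce
  then show ?case using Suc.prems by fastforce
qed

lemma Ck_on_const: "open S \<Longrightarrow> Ck_on n S (\<lambda>x. c)"
proof (induction n arbitrary: c)
  case (Suc n)
  show ?case by (rule Ck_on_SucI[where D = "\<lambda>x v. 0"]) (use Suc in auto)
qed auto

lemma Ck_on_bounded_linear:
  assumes "open S" "bounded_linear f"
  shows "Ck_on n S f"
proof (cases n)
  case 0
  then show ?thesis using assms by (simp add: linear_continuous_on)
next
  case (Suc m)
  have "Ck_on (Suc m) S f"
    by (rule Ck_on_SucI[where D = "\<lambda>x. f"])
      (use assms in \<open>auto intro: Ck_on_const bounded_linear_imp_has_derivative\<close>)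
  then show ?thesis using Suc by simp
qed

lemma Ck_on_linear_image:
  assumes "open S" "bounded_linear L" "Ck_on n S f"
  shows "Ck_on n S (\<lambda>x. L (f x))"
  using assms(3)
proof (induction n arbitrary: f)
  case 0
  then show ?case using assms(2) by (simp add: bounded_linear.continuous_on)
next
  case (Suc n)
  show ?case
  proof (rule Ck_on_SucI[OF assms(1)])
    show "((\<lambda>x. L (f x)) has_derivative (\<lambda>v. L (frechet_derivative f (at x) v))) (at x)"
      if "x \<in> S" for x
      by (rule bounded_linear.has_derivative[OF assms(2) Ck_on_Suc_has_derivative[OF Suc.prems that]])
    show "Ck_on n S (\<lambda>x. L (frechet_derivative f (at x) v))" for v
      using Suc.prems by (intro Suc.IH) auto
  qed
qed

lemma Ck_on_add:
  assumes "open S" "Ck_on n S f" "Ck_on n S g"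
  shows "Ck_on n S (\<lambda>x. f x + g x)"
  using assms(2,3)
proof (induction n arbitrary: f g)
  case 0
  then show ?case by (auto intro: continuous_intros)
next
  case (Suc n)
  show ?case
    by (rule Ck_on_SucI[where D = "\<lambda>x v. frechet_derivative f (at x) v + frechet_derivative g (at x) v"])
      (use Suc assms(1) in \<open>auto intro!: has_derivative_add Ck_on_Suc_has_derivative\<close>)
qed

lemma Ck_on_scaleR:
  fixes f :: "'a::real_normed_vector \<Rightarrow> real"
  assumes "open S" "Ck_on n S f" "Ck_on n S g"
  shows "Ck_on n S (\<lambda>x. f x *\<^sub>R g x)"
  using assms(2,3)
proof (induction n arbitrary: f g)
  case 0
  then show ?case by (auto intro: continuous_intros)
next
  case (Suc n)
  show ?case
  proof (rule Ck_on_SucI[OF assms(1)])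
    fix x assume "x \<in> S"
    then show "((\<lambda>x. f x *\<^sub>R g x) has_derivative
      (\<lambda>v. f x *\<^sub>R frechet_derivative g (at x) v + frechet_derivative f (at x) v *\<^sub>R g x)) (at x)"
      using Suc.prems by (intro has_derivative_scaleR Ck_on_Suc_has_derivative)
  next
    fix v
    show "Ck_on n S (\<lambda>x. f x *\<^sub>R frechet_derivative g (at x) v + frechet_derivative f (at x) v *\<^sub>R g x)"
      using Suc.prems Ck_on_SucD[of n S f] Ck_on_SucD[of n S g]
      by (intro Ck_on_add assms(1) Suc.IH) auto
  qed
qed

lemma Ck_on_mult:
  fixes f g :: "'a::real_normed_vector \<Rightarrow> real"
  assumes "open S" "Ck_on n S f" "Ck_on n S g"
  shows "Ck_on n S (\<lambda>x. f x * g x)"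
  using Ck_on_scaleR[OF assms] by simp

lemma Ck_on_sum:
  assumes "open S" "\<And>i. i \<in> I \<Longrightarrow> Ck_on n S (f i)"
  shows "Ck_on n S (\<lambda>x. \<Sum>i\<in>I. f i x)"
  using assms(2)
proof (induction I rule: infinite_finite_induct)
  case (insert i I)
  then show ?case using Ck_on_add[OF assms(1), of n "f i" "\<lambda>x. \<Sum>i\<in>I. f i x"] by simp
qed (simp_all add: Ck_on_const assms(1))

text \<open>The chain rule gives a derivative in which x occurs both in the base point and in the
  direction. Expanding the direction in \<open>Basis\<close> turns it into a finite sum of scalars
  times partial derivatives of g composed with f; the induction hypothesis applies to those, with f
  fixed and g varying.\<close>

lemma Ck_on_compose:
  fixes f :: "'a::real_normed_vector \<Rightarrow> 'b::euclidean_space" and g :: "'b \<Rightarrow> 'c::real_normed_vector"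
  assumes "open S" "open T" "f ` S \<subseteq> T" "Ck_on n S f" "Ck_on n T g"
  shows "Ck_on n S (\<lambda>x. g (f x))"
  using assms(4,5)
proof (induction n arbitrary: g)
  case 0
  then show ?case using continuous_on_compose2[of T g S f] assms(3) by simp
next
  case (Suc n)
  show ?case
  proof (rule Ck_on_SucI[OF assms(1)])
    fix x assume x: "x \<in> S"
    then have fx: "f x \<in> T" using assms(3) by blast
    define Dg where "Dg = frechet_derivative g (at (f x))"
    have g: "(g has_derivative Dg) (at (f x))"
      unfolding Dg_def by (rule Ck_on_Suc_has_derivative[OF Suc.prems(2) fx])
    have f: "(f has_derivative frechet_derivative f (at x)) (at x)"
      by (rule Ck_on_Suc_has_derivative[OF Suc.prems(1) x])
    have lin: "linear Dg" using g by (rule has_derivative_linear)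
    have Dg: "Dg w = (\<Sum>b\<in>Basis. (w \<bullet> b) *\<^sub>R Dg b)" for w
    proof -
      have "Dg w = Dg (\<Sum>b\<in>Basis. (w \<bullet> b) *\<^sub>R b)" by (simp add: euclidean_representation)
      also have "\<dots> = (\<Sum>b\<in>Basis. (w \<bullet> b) *\<^sub>R Dg b)"
        using lin by (simp add: linear_sum linear_cmul)
      finally show ?thesis .
    qed
    show "((\<lambda>x. g (f x)) has_derivative (\<lambda>v. \<Sum>b\<in>Basis.
        (frechet_derivative f (at x) v \<bullet> b) *\<^sub>R frechet_derivative g (at (f x)) b)) (at x)"
      using has_derivative_compose[OF f g] unfolding Dg[of "frechet_derivative f (at x) v" for v]
      by (simp only: Dg_def)
  next
    fix v
    have "Ck_on n S (\<lambda>x. frechet_derivative f (at x) v)"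
      using Suc.prems(1) unfolding Ck_on.simps(2) by blast
    then have df: "Ck_on n S (\<lambda>x. frechet_derivative f (at x) v \<bullet> b)" for b
      by (rule Ck_on_linear_image[OF assms(1) bounded_linear_inner_left])
    have "Ck_on n T (\<lambda>y. frechet_derivative g (at y) b)" for b
      using Suc.prems(2) unfolding Ck_on.simps(2) by blast
    then have dg: "Ck_on n S (\<lambda>x. frechet_derivative g (at (f x)) b)" for b
      by (rule Suc.IH[OF Ck_on_SucD[OF Suc.prems(1)]])
    show "Ck_on n S (\<lambda>x. \<Sum>b\<in>Basis.
        (frechet_derivative f (at x) v \<bullet> b) *\<^sub>R frechet_derivative g (at (f x)) b)"
      by (rule Ck_on_sum[OF assms(1) Ck_on_scaleR[OF assms(1) df dg]])
  qed
qed

lemma Ck_on_real_SucI: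
  fixes f :: "real \<Rightarrow> real"
  assumes "open S" "\<And>x. x \<in> S \<Longrightarrow> (f has_real_derivative D x) (at x)" "Ck_on n S D"
  shows "Ck_on (Suc n) S f"
  by (rule Ck_on_SucI[where D = "\<lambda>x v. D x * v"])
    (use assms in \<open>simp_all add: has_field_derivative_def Ck_on_mult Ck_on_const\<close>)

section \<open>Smooth functions of one real variable\<close>

lemma Cinf_on_exp: "Cinf_on UNIV (exp :: real \<Rightarrow> real)"
  unfolding Cinf_on_def
proof
  show "Ck_on n UNIV (exp :: real \<Rightarrow> real)" for n
    by (induction n) (auto intro: continuous_intros Ck_on_real_SucI[OF open_UNIV DERIV_exp] simp del: Ck_on.simps(2))
qed

lemma Cinf_on_inverse: "Cinf_on (- {0}) (inverse :: real \<Rightarrow> real)"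
  unfolding Cinf_on_def
proof
  fix n
  show "Ck_on n (- {0}) (inverse :: real \<Rightarrow> real)"
  proof (induction n)
    case (Suc n)
    show ?case
    proof (rule Ck_on_real_SucI[where D = "\<lambda>x. (- 1) * (inverse x * inverse x)"])
      show "Ck_on n (- {0}) (\<lambda>x. (- 1) * (inverse x * inverse x :: real))"
        by (intro Ck_on_mult Ck_on_const Suc) auto
    qed (auto intro!: derivative_eq_intros)
  qed (auto intro: continuous_intros)
qed

lemma Cinf_on_powser:
  fixes c :: "nat \<Rightarrow> real"
  assumes "\<And>x. summable (\<lambda>n. c n * x ^ n)"
  shows "Cinf_on UNIV (\<lambda>x. \<Sum>n. c n * x ^ n)"
  unfolding Cinf_on_def
proof
  show "Ck_on k UNIV (\<lambda>x. \<Sum>n. c n * x ^ n)" for k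
    using assms
  proof (induction k arbitrary: c)
    case 0
    have "isCont (\<lambda>x. \<Sum>n. c n * x ^ n) x" for x
      using termdiffs_strong_converges_everywhere[OF 0] DERIV_isCont by blast
    then show ?case by (simp add: continuous_at_imp_continuous_on)
  next
    case (Suc k)
    show ?case
      by (rule Ck_on_real_SucI[where D = "\<lambda>x. \<Sum>n. diffs c n * x ^ n"])
        (auto intro!: termdiffs_strong_converges_everywhere Suc termdiff_converges_all)
  qed
qed

text \<open>Hadamard's lemma for the exponential, with g(x) = (exp x - 1)/x given by its power
  series so that smoothness at 0 is immediate. It makes derivations of exp(h) accessible to the
  Leibniz rule.\<close>

lemma exp_factorization:
  obtains g :: "real \<Rightarrow> real" where "Cinf_on UNIV g" "g 0 = 1" "\<And>x. exp x = 1 + x * g x"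
proof
  let ?c = "\<lambda>n. inverse (fact (Suc n)) :: real"
  let ?g = "\<lambda>x. \<Sum>n. ?c n * x ^ n"
  have e: "(\<lambda>n. inverse (fact n) * x ^ n) sums exp x" for x :: real
    using exp_converges[of x] by simp
  have s: "(\<lambda>n. x * (?c n * x ^ n)) sums (exp x - 1)" for x
    using iffD2[OF sums_Suc_iff, of "\<lambda>n. inverse (fact n) * x ^ n" "exp x - 1"] e[of x]
    by (simp add: algebra_simps)
  have summ: "summable (\<lambda>n. ?c n * x ^ n)" for x
  proof (cases "x = 0")
    case False
    then show ?thesis using sums_summable[OF s[of x]] by simp
  qed (simp add: summable_0_powser)
  show "Cinf_on UNIV ?g" by (rule Cinf_on_powser[OF summ])
  show "?g 0 = 1" using suminf_mult[of "\<lambda>n. ?c n * 0 ^ n" 1] by (simp add: powser_zero)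
  show "exp x = 1 + x * ?g x" for x
    using sums_unique[OF s[of x]] suminf_mult[OF summ[of x], of x] by simp
qed

text \<open>The usual flat function is the case n = 0. The powers of 1/t are included because the
  family is then closed under differentiation up to linear combinations, so an induction on the
  order of differentiability covers all n at once.\<close>

definition bump_profile :: "nat \<Rightarrow> real \<Rightarrow> real" where
  "bump_profile n t = (if 0 < t then inverse t ^ n * exp (- inverse t) else 0)"

text \<open>With x = 1/t the difference quotient from the right is x^(n+1)/exp x, which tends to 0
  at infinity; from the left it is 0.\<close>

lemma bump_profile_deriv_0: "(bump_profile n has_real_derivative 0) (at 0)"
proof -
  have lim: "((\<lambda>t. inverse t ^ Suc n * exp (- inverse t)) \<longlongrightarrow> 0) (at_right (0::real))"
  proof -
    have "((\<lambda>x::real. x ^ Suc n / exp x) \<longlongrightarrow> 0) at_top" by (rule tendsto_power_div_exp_0)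
    from filterlim_compose[OF this filterlim_inverse_at_top_right]
    show ?thesis by (simp add: exp_minus field_simps)
  qed
  have "((\<lambda>t. bump_profile n t / t) \<longlongrightarrow> 0) (at_right 0)"
    by (rule Lim_transform_eventually[OF lim])
      (auto simp: eventually_at_filter bump_profile_def field_simps)
  moreover have "((\<lambda>t. bump_profile n t / t) \<longlongrightarrow> 0) (at_left 0)"
    by (rule Lim_transform_eventually[OF tendsto_const])
      (auto simp: eventually_at_filter bump_profile_def)
  ultimately have "((\<lambda>t. bump_profile n t / t) \<longlongrightarrow> 0) (at 0)"
    by (simp add: filterlim_split_at)
  then show ?thesis by (simp add: has_field_derivative_iff bump_profile_def)
qed

lemma bump_profile_deriv:
  "(bump_profile n has_real_derivative
     bump_profile (n + 2) t + (- real n) * bump_profile (n + 1) t) (at t)"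
proof -
  consider "t < 0" | "t = 0" | "0 < t" by linarith
  then show ?thesis
  proof cases
    case 1
    have "((\<lambda>t. 0) has_real_derivative 0) (at t)" by simp
    then have "(bump_profile n has_real_derivative 0) (at t)"
      by (rule has_field_derivative_transform_within_open[where S = "{..<0}"])
        (use 1 in \<open>auto simp: bump_profile_def\<close>)
    then show ?thesis using 1 by (simp add: bump_profile_def)
  next
    case 2
    then show ?thesis using bump_profile_deriv_0[of n] by (simp add: bump_profile_def)
  next
    case 3
    have pow: "((\<lambda>t. inverse t ^ n) has_real_derivative - (real n * inverse t ^ (n + 1))) (at t)"
    proof (induction n)
      case (Suc n)
      from 3 have "t \<noteq> 0" by simp
      from DERIV_mult[OF DERIV_inverse[OF this] Suc] show ?case by (simp add: algebra_simps)
    qed simp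
    have "((\<lambda>t. inverse t ^ n * exp (- inverse t)) has_real_derivative
       bump_profile (n + 2) t + (- real n) * bump_profile (n + 1) t) (at t)"
      by (rule derivative_eq_intros pow refl)+
        (use 3 in \<open>auto simp: bump_profile_def algebra_simps\<close>)
    then show ?thesis
      by (rule has_field_derivative_transform_within_open[where S = "{0<..}"])
        (use 3 in \<open>auto simp: bump_profile_def\<close>)
  qed
qed

lemma Cinf_on_bump_profile: "Cinf_on UNIV (bump_profile n)"
  unfolding Cinf_on_def
proof
  show "Ck_on k UNIV (bump_profile n)" for k
  proof (induction k arbitrary: n)
    case 0
    have "isCont (bump_profile n) t" for t using bump_profile_deriv DERIV_isCont by blast
    then show ?case by (simp add: continuous_at_imp_continuous_on)
  next
    case (Suc k)
    show ?case
      by (rule Ck_on_real_SucI[OF open_UNIV bump_profile_deriv])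
        (intro Ck_on_add Ck_on_mult Ck_on_const Suc open_UNIV)
  qed
qed

section \<open>Smooth functions and derivations\<close>

lemma smooth_fun_on_iff:
  "smooth_fun_on A W f \<longleftrightarrow>
    (\<forall>U \<phi> n. (U, \<phi>) \<in> A \<longrightarrow> Ck_on n (\<phi> ` (U \<inter> W)) (\<lambda>x. f (inv_into U \<phi> x)))"
  by (auto simp: smooth_fun_on_def Cinf_on_def o_def)

lemma smooth_fun_on_subset: "smooth_fun_on A W f \<Longrightarrow> V \<subseteq> W \<Longrightarrow> smooth_fun_on A V f"
  unfolding smooth_fun_on_iff by (meson Ck_on_subset Int_mono image_mono order_refl)

text \<open>The squared distance is expanded in coordinates, where it is a polynomial. The resulting
  function is positive exactly where the squared distance to x0 is below r.\<close>

lemma Ck_on_bump_ball: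
  fixes x0 :: "'a::euclidean_space"
  shows "Ck_on n UNIV (\<lambda>y. bump_profile 0 (r - (y - x0) \<bullet> (y - x0)))"
proof -
  have lin: "Ck_on n UNIV (\<lambda>y. y \<bullet> b + - (x0 \<bullet> b))" for b :: 'a
    by (rule Ck_on_add[OF open_UNIV Ck_on_bounded_linear[OF open_UNIV bounded_linear_inner_left]
      Ck_on_const[OF open_UNIV]])
  have eq: "r - (y - x0) \<bullet> (y - x0)
      = r + (\<Sum>b\<in>Basis. (- 1) * ((y \<bullet> b + - (x0 \<bullet> b)) * (y \<bullet> b + - (x0 \<bullet> b))))" for y
    by (subst euclidean_inner) (simp add: inner_diff_left sum_negf)
  have "Ck_on n UNIV (\<lambda>y. r - (y - x0) \<bullet> (y - x0))"
    unfolding eq by (intro Ck_on_add Ck_on_const Ck_on_sum Ck_on_mult lin open_UNIV)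
  moreover have "Ck_on n UNIV (bump_profile 0)"
    using Cinf_on_bump_profile[of 0] unfolding Cinf_on_def by blast
  ultimately show ?thesis by (rule Ck_on_compose[OF open_UNIV open_UNIV subset_UNIV])
qed

section \<open>Charts and the algebra of smooth functions\<close>

locale smooth_mfd =
  fixes A :: "('m::{t2_space,second_countable_topology}, 'n::finite) chart set"
  assumes mfd: "smooth_manifold A"
begin

lemma chart_at:
  obtains U \<phi> where "(U, \<phi>) \<in> A" "p \<in> U"
proof -
  have "(\<Union>(U, \<phi>)\<in>A. U) = UNIV"
    using mfd unfolding smooth_manifold_def by (rule conjunct1)
  then have "p \<in> (\<Union>(U, \<phi>)\<in>A. U)" by simp
  then show ?thesis using that by blast
qed

lemma
  assumes "(U, \<phi>) \<in> A"
  shows open_chart_domain: "open U"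
    and open_chart_range: "open (\<phi> ` U)"
    and homeomorphism_chart: "homeomorphism U (\<phi> ` U) \<phi> (inv_into U \<phi>)"
  using mfd assms unfolding smooth_manifold_def by blast+

lemma inv_chart: "(U, \<phi>) \<in> A \<Longrightarrow> q \<in> U \<Longrightarrow> inv_into U \<phi> (\<phi> q) = q"
  using homeomorphism_chart homeomorphism_apply1 by blast

lemma transition_smooth:
  assumes "(U, \<phi>) \<in> A" "(V, \<psi>) \<in> A"
  shows "Ck_on n (\<phi> ` (U \<inter> V)) (\<lambda>x. \<psi> (inv_into U \<phi> x))"
proof -
  have "Cinf_on (\<phi> ` (U \<inter> V)) (\<psi> \<circ> inv_into U \<phi>)"
    using mfd assms unfolding smooth_manifold_def by blast
  then show ?thesis by (simp add: Cinf_on_def o_def)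
qed

lemma open_chart_image:
  assumes "(U, \<phi>) \<in> A" "open W"
  shows "open (\<phi> ` (U \<inter> W))"
proof -
  have "openin (top_of_set (\<phi> ` U)) (\<phi> ` (U \<inter> W))"
    using homeomorphism_imp_open_map[OF homeomorphism_chart[OF assms(1)]] assms(2) by blast
  then show ?thesis using open_chart_range[OF assms(1)] openin_open_trans by blast
qed

lemma smooth_fun_on_local:
  assumes "\<And>p. p \<in> W \<Longrightarrow> \<exists>V. open V \<and> p \<in> V \<and> smooth_fun_on A V f"
  shows "smooth_fun_on A W f"
  unfolding smooth_fun_on_iff
proof (intro allI impI Ck_on_local)
  fix U \<phi> n x
  assume U: "(U, \<phi>) \<in> A" and "x \<in> \<phi> ` (U \<inter> W)"
  then obtain p where p: "p \<in> U" "p \<in> W" "x = \<phi> p" by blast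
  from assms[OF p(2)] obtain V where V: "open V" "p \<in> V" "smooth_fun_on A V f" by blast
  show "\<exists>T. open T \<and> x \<in> T \<and> Ck_on n T (\<lambda>x. f (inv_into U \<phi> x))"
    using open_chart_image[OF U V(1)] V(2,3) p U unfolding smooth_fun_on_iff by blast
qed

lemma smooth_fun_on_cong:
  assumes "open W" "\<And>q. q \<in> W \<Longrightarrow> f q = g q" "smooth_fun_on A W f"
  shows "smooth_fun_on A W g"
  unfolding smooth_fun_on_iff
proof (intro allI impI)
  fix U \<phi> n assume U: "(U, \<phi>) \<in> A"
  show "Ck_on n (\<phi> ` (U \<inter> W)) (\<lambda>x. g (inv_into U \<phi> x))"
  proof (rule Ck_on_cong[OF open_chart_image[OF U assms(1)]])
    show "Ck_on n (\<phi> ` (U \<inter> W)) (\<lambda>x. f (inv_into U \<phi> x))"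
      using assms(3) U unfolding smooth_fun_on_iff by blast
    show "f (inv_into U \<phi> x) = g (inv_into U \<phi> x)" if "x \<in> \<phi> ` (U \<inter> W)" for x
      using that assms(2) inv_chart[OF U] by auto
  qed
qed

lemma smooth_fun_on_const: "open W \<Longrightarrow> smooth_fun_on A W (\<lambda>q. c)"
  unfolding smooth_fun_on_iff by (simp add: Ck_on_const open_chart_image)

lemma smooth_fun_on_add:
  "open W \<Longrightarrow> smooth_fun_on A W f \<Longrightarrow> smooth_fun_on A W g \<Longrightarrow> smooth_fun_on A W (\<lambda>q. f q + g q)"
  unfolding smooth_fun_on_iff by (simp add: Ck_on_add open_chart_image)

lemma smooth_fun_on_mult:
  "open W \<Longrightarrow> smooth_fun_on A W f \<Longrightarrow> smooth_fun_on A W g \<Longrightarrow> smooth_fun_on A W (\<lambda>q. f q * g q)"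
  unfolding smooth_fun_on_iff by (simp add: Ck_on_mult open_chart_image)

lemma smooth_fun_on_sum:
  "open W \<Longrightarrow> (\<And>i. i \<in> I \<Longrightarrow> smooth_fun_on A W (f i)) \<Longrightarrow> smooth_fun_on A W (\<lambda>q. \<Sum>i\<in>I. f i q)"
  unfolding smooth_fun_on_iff by (simp add: Ck_on_sum open_chart_image)

lemma smooth_fun_on_compose:
  fixes g :: "real \<Rightarrow> real"
  assumes "open W" "open T" "f ` W \<subseteq> T" "Cinf_on T g" "smooth_fun_on A W f"
  shows "smooth_fun_on A W (\<lambda>q. g (f q))"
  unfolding smooth_fun_on_iff
proof (intro allI impI)
  fix U \<phi> n assume U: "(U, \<phi>) \<in> A"
  have "(\<lambda>x. f (inv_into U \<phi> x)) ` (\<phi> ` (U \<inter> W)) \<subseteq> T"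
    using assms(3) inv_chart[OF U] by auto
  moreover have "Ck_on n (\<phi> ` (U \<inter> W)) (\<lambda>x. f (inv_into U \<phi> x))" "Ck_on n T g"
    using assms(4,5) U unfolding smooth_fun_on_iff Cinf_on_def by blast+
  ultimately show "Ck_on n (\<phi> ` (U \<inter> W)) (\<lambda>x. g (f (inv_into U \<phi> x)))"
    by (rule Ck_on_compose[OF open_chart_image[OF U assms(1)] assms(2)])
qed

lemma smooth_fun_on_continuous:
  assumes "open W" "smooth_fun_on A W f" "p \<in> W"
  shows "isCont f p"
proof -
  obtain U \<phi> where U: "(U, \<phi>) \<in> A" "p \<in> U" by (rule chart_at)
  have "continuous_on (\<phi> ` (U \<inter> W)) (\<lambda>x. f (inv_into U \<phi> x))"
    using assms(2) U(1) unfolding smooth_fun_on_iff by (metis Ck_on.simps(1))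
  moreover have "continuous_on (U \<inter> W) \<phi>"
    using homeomorphism_chart[OF U(1)] by (meson Int_lower1 continuous_on_subset homeomorphism_cont1)
  ultimately have "continuous_on (U \<inter> W) (\<lambda>q. f (inv_into U \<phi> (\<phi> q)))"
    by (rule continuous_on_compose2) auto
  then have "continuous_on (U \<inter> W) f"
    by (rule continuous_on_eq) (simp add: inv_chart[OF U(1)])
  then show ?thesis
    using U(2) assms(1,3) open_chart_domain[OF U(1)] by (simp add: continuous_on_eq_continuous_at open_Int)
qed

text \<open>A bump on a closed ball inside a chart is extended by 0. The preimage K of the ball is
  compact, hence closed in a Hausdorff space, so the extension is smooth on the open set outside K
  as well. A nonzero value at p suffices, since \<open>smooth_near_extend\<close> divides by
  it.\<close>

lemma bump_function:
  assumes "open W" "p \<in> W"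
  obtains \<beta> K where "smooth_fun_on A UNIV \<beta>" "\<beta> p \<noteq> 0" "closed K" "K \<subseteq> W" "\<And>q. q \<notin> K \<Longrightarrow> \<beta> q = 0"
proof -
  obtain U \<phi> where U: "(U, \<phi>) \<in> A" "p \<in> U" by (rule chart_at)
  have "\<phi> p \<in> \<phi> ` (U \<inter> W)" using U(2) assms(2) by blast
  then obtain e where e: "e > 0" "cball (\<phi> p) e \<subseteq> \<phi> ` (U \<inter> W)"
    using open_chart_image[OF U(1) assms(1)] open_contains_cball by metis
  define G where "G = (\<lambda>y. bump_profile 0 (e\<^sup>2 - (y - \<phi> p) \<bullet> (y - \<phi> p)))"
  define \<beta> where "\<beta> q = (if q \<in> U then G (\<phi> q) else 0)" for q
  define K where "K = inv_into U \<phi> ` cball (\<phi> p) e"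
  have "continuous_on (cball (\<phi> p) e) (inv_into U \<phi>)"
    using homeomorphism_cont2[OF homeomorphism_chart[OF U(1)]] e(2)
    by (rule continuous_on_subset[OF _ order_trans]) auto
  then have K: "closed K"
    unfolding K_def by (intro compact_imp_closed compact_continuous_image) auto
  have KW: "K \<subseteq> W" using e(2) inv_chart[OF U(1)] unfolding K_def by auto
  have off: "\<beta> q = 0" if "q \<notin> K" for q
  \<comment> \<open>A point outside the chart, or at distance at least e from the centre in it, has
    value 0 by definition; any other point would lie in K.\<close>
  proof (cases "q \<in> U \<and> (\<phi> q - \<phi> p) \<bullet> (\<phi> q - \<phi> p) < e\<^sup>2")
    case True
    then have "norm (\<phi> q - \<phi> p) < e"
      using e(1) by (simp add: power2_norm_eq_inner[symmetric] power2_less_imp_less)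
    then have "\<phi> q \<in> cball (\<phi> p) e" by (simp add: dist_norm norm_minus_commute)
    then have "q \<in> K" unfolding K_def using True inv_chart[OF U(1), of q] by (metis image_eqI)
    with that show ?thesis by simp
  qed (auto simp: \<beta>_def G_def bump_profile_def)
  have "smooth_fun_on A UNIV \<beta>"
  proof (rule smooth_fun_on_local)
    fix q :: 'm
    show "\<exists>V. open V \<and> q \<in> V \<and> smooth_fun_on A V \<beta>"
    proof (cases "q \<in> K")
      case False
      have "smooth_fun_on A (- K) \<beta>"
        by (rule smooth_fun_on_cong[OF _ _ smooth_fun_on_const[of _ 0]]) (use K off in auto)
      with False K show ?thesis by (intro exI[of _ "- K"]) auto
    next
      case True
      have "K \<subseteq> U" using e(2) inv_chart[OF U(1)] unfolding K_def by auto
      have "smooth_fun_on A U \<beta>"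
        unfolding smooth_fun_on_iff
      proof (intro allI impI)
        fix V \<psi> n assume V: "(V, \<psi>) \<in> A"
        have op: "open (\<psi> ` (V \<inter> U))" by (rule open_chart_image[OF V open_chart_domain[OF U(1)]])
        show "Ck_on n (\<psi> ` (V \<inter> U)) (\<lambda>x. \<beta> (inv_into V \<psi> x))"
        proof (rule Ck_on_cong[OF op])
          show "Ck_on n (\<psi> ` (V \<inter> U)) (\<lambda>x. G (\<phi> (inv_into V \<psi> x)))"
            by (rule Ck_on_compose[OF op open_UNIV _ transition_smooth[OF V U(1)]])
              (auto simp: G_def Ck_on_bump_ball)
          show "G (\<phi> (inv_into V \<psi> x)) = \<beta> (inv_into V \<psi> x)" if "x \<in> \<psi> ` (V \<inter> U)" for x
            using that inv_chart[OF V] by (auto simp: \<beta>_def)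
        qed
      qed
      with True \<open>K \<subseteq> U\<close> open_chart_domain[OF U(1)] show ?thesis by blast
    qed
  qed
  moreover have "\<beta> p \<noteq> 0" using U(2) e(1) by (simp add: \<beta>_def G_def bump_profile_def)
  ultimately show ?thesis using that K KW off by blast
qed

section \<open>Smoothness near a point\<close>

lemma smooth_near_of_smooth_on: "open W \<Longrightarrow> p \<in> W \<Longrightarrow> smooth_fun_on A W f \<Longrightarrow> smooth_near A p f"
  unfolding smooth_near_def by blast

lemma smooth_near_eventually: "smooth_near A p f \<Longrightarrow> \<forall>\<^sub>F q in nhds p. smooth_near A q f"
  unfolding smooth_near_def eventually_nhds by blast

lemma smooth_near_cong:
  assumes "smooth_near A p f" "\<forall>\<^sub>F q in nhds p. f q = g q"
  shows "smooth_near A p g"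
proof -
  obtain W where W: "open W" "p \<in> W" "smooth_fun_on A W f" using assms(1) unfolding smooth_near_def by blast
  obtain V where V: "open V" "p \<in> V" "\<And>q. q \<in> V \<Longrightarrow> f q = g q" using assms(2) unfolding eventually_nhds by blast
  have "smooth_fun_on A (V \<inter> W) g"
    by (rule smooth_fun_on_cong[OF _ _ smooth_fun_on_subset[OF W(3)]]) (use V W in auto)
  then show ?thesis using V W by (intro smooth_near_of_smooth_on[of "V \<inter> W"]) auto
qed

lemma smooth_near_const: "smooth_near A p (\<lambda>q. c)"
  by (rule smooth_near_of_smooth_on[OF open_UNIV UNIV_I smooth_fun_on_const[OF open_UNIV]])

lemma smooth_near_common:
  assumes "smooth_near A p f" "smooth_near A p g"
  obtains W where "open W" "p \<in> W" "smooth_fun_on A W f" "smooth_fun_on A W g"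
proof -
  obtain V W where "open W" "p \<in> W" "smooth_fun_on A W f" "open V" "p \<in> V" "smooth_fun_on A V g"
    using assms unfolding smooth_near_def by blast
  then show ?thesis using that[of "V \<inter> W"] by (auto intro: smooth_fun_on_subset)
qed

lemma smooth_near_add: "smooth_near A p f \<Longrightarrow> smooth_near A p g \<Longrightarrow> smooth_near A p (\<lambda>q. f q + g q)"
  by (erule smooth_near_common, assumption) (rule smooth_near_of_smooth_on[OF _ _ smooth_fun_on_add])

lemma smooth_near_mult: "smooth_near A p f \<Longrightarrow> smooth_near A p g \<Longrightarrow> smooth_near A p (\<lambda>q. f q * g q)"
  by (erule smooth_near_common, assumption) (rule smooth_near_of_smooth_on[OF _ _ smooth_fun_on_mult])

lemma smooth_near_linear:
  "smooth_near A p f \<Longrightarrow> smooth_near A p g \<Longrightarrow> smooth_near A p (\<lambda>q. a * f q + b * g q)"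
  by (intro smooth_near_add smooth_near_mult smooth_near_const)

lemma smooth_near_diff: "smooth_near A p f \<Longrightarrow> smooth_near A p g \<Longrightarrow> smooth_near A p (\<lambda>q. f q - g q)"
  using smooth_near_linear[of p f g 1 "- 1"] by simp

lemma smooth_near_sum:
  "(\<And>i. i \<in> I \<Longrightarrow> smooth_near A p (f i)) \<Longrightarrow> smooth_near A p (\<lambda>q. \<Sum>i\<in>I. f i q)"
  by (induction I rule: infinite_finite_induct) (simp_all add: smooth_near_const smooth_near_add)

lemma smooth_near_continuous: "smooth_near A p f \<Longrightarrow> isCont f p"
  unfolding smooth_near_def using smooth_fun_on_continuous by blast

section \<open>Calculus with tangent vectors\<close>

lemma tv_linear:
  "v \<in> tangent_space A p \<Longrightarrow> smooth_near A p f \<Longrightarrow> smooth_near A p g \<Longrightarrow>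
    v (\<lambda>q. a * f q + b * g q) = a * v f + b * v g"
  unfolding tangent_space_def by blast

lemma tv_mult:
  "v \<in> tangent_space A p \<Longrightarrow> smooth_near A p f \<Longrightarrow> smooth_near A p g \<Longrightarrow>
    v (\<lambda>q. f q * g q) = v f * g p + f p * v g"
  unfolding tangent_space_def by blast

lemma tv_ext: "v \<in> tangent_space A p \<Longrightarrow> \<not> smooth_near A p f \<Longrightarrow> v f = 0"
  unfolding tangent_space_def by blast

lemma tv_const:
  assumes "v \<in> tangent_space A p"
  shows "v (\<lambda>q. c) = 0"
proof -
  have "v (\<lambda>q. 1) = 0" using tv_mult[OF assms smooth_near_const[of p 1] smooth_near_const[of p 1]] by simp
  then show ?thesis
    using tv_linear[OF assms smooth_near_const[of p 1] smooth_near_const[of p 1], of c 0] by simp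
qed

lemma tv_add:
  "v \<in> tangent_space A p \<Longrightarrow> smooth_near A p f \<Longrightarrow> smooth_near A p g \<Longrightarrow> v (\<lambda>q. f q + g q) = v f + v g"
  using tv_linear[of v p f g 1 1] by simp

lemma tv_diff:
  "v \<in> tangent_space A p \<Longrightarrow> smooth_near A p f \<Longrightarrow> smooth_near A p g \<Longrightarrow> v (\<lambda>q. f q - g q) = v f - v g"
  using tv_linear[of v p f g 1 "- 1"] by simp

lemma tv_cmult:
  "v \<in> tangent_space A p \<Longrightarrow> smooth_near A p f \<Longrightarrow> v (\<lambda>q. a * f q) = a * v f"
  using tv_linear[of v p f f a 0] by simp

lemma tv_sum:
  assumes "v \<in> tangent_space A p" "\<And>i. i \<in> I \<Longrightarrow> smooth_near A p (f i)"
  shows "v (\<lambda>q. \<Sum>i\<in>I. f i q) = (\<Sum>i\<in>I. v (f i))"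
  using assms(2)
proof (induction I rule: infinite_finite_induct)
  case (insert i I)
  then show ?case
    using tv_add[OF assms(1), of "f i" "\<lambda>q. \<Sum>i\<in>I. f i q"] smooth_near_sum[of I p f] by simp
qed (simp_all add: tv_const[OF assms(1)])

text \<open>The Leibniz rule is applied to the indicator function of a neighbourhood of \<open>p\<close>.\<close>
lemma tv_germ:
  assumes v: "v \<in> tangent_space A p" and f: "smooth_near A p f"
    and eq: "\<forall>\<^sub>F q in nhds p. f q = g q"
  shows "v f = v g"
proof -
  obtain V where V: "open V" "p \<in> V" "\<And>q. q \<in> V \<Longrightarrow> f q = g q" using eq unfolding eventually_nhds by blast
  let ?h = "\<lambda>q. f q - g q" and ?i = "\<lambda>q. if q \<in> V then 1 else 0 :: real"
  have g: "smooth_near A p g" by (rule smooth_near_cong[OF f eq])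
  have i: "smooth_near A p ?i"
    by (rule smooth_near_cong[OF smooth_near_const[of p 1]]) (use V in \<open>auto simp: eventually_nhds\<close>)
  have "(\<lambda>q. ?i q * ?h q) = (\<lambda>q. 0)" using V by auto
  then have "v ?h = 0"
    using tv_mult[OF v i smooth_near_diff[OF f g]] tv_const[OF v, of 0] V by simp
  then show ?thesis using tv_diff[OF v f g] by simp
qed

text \<open>The function multiplied by the bump is f - f(p), which vanishes at p. In the Leibniz
  rule this kills the term with the derivative of the bump, so dividing by the value at p already
  gives the right derivatives without a bump that is constant near p.\<close>

lemma smooth_near_extend:
  assumes f: "smooth_near A p f"
  obtains F where "smooth_fun_on A UNIV F" "F p = 0" "\<And>v. v \<in> tangent_space A p \<Longrightarrow> v F = v f"
proof -
  obtain W where W: "open W" "p \<in> W" "smooth_fun_on A W f" using f unfolding smooth_near_def by blast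
  obtain \<beta> K where \<beta>: "smooth_fun_on A UNIV \<beta>" "\<beta> p \<noteq> 0" "closed K" "K \<subseteq> W" "\<And>q. q \<notin> K \<Longrightarrow> \<beta> q = 0"
    by (rule bump_function[OF W(1,2)]) blast
  define F where "F = (\<lambda>q. \<beta> q * ((1 / \<beta> p) * (f q + - f p)))"
  have "smooth_fun_on A UNIV F"
  proof (rule smooth_fun_on_local)
    fix q :: 'm
    show "\<exists>V. open V \<and> q \<in> V \<and> smooth_fun_on A V F"
    proof (cases "q \<in> K")
      case False
      have "smooth_fun_on A (- K) F"
        by (rule smooth_fun_on_cong[OF _ _ smooth_fun_on_const[of _ 0]]) (use \<beta> in \<open>auto simp: F_def\<close>)
      with False \<beta>(3) show ?thesis by (intro exI[of _ "- K"]) auto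
    next
      case True
      have "smooth_fun_on A W F"
        unfolding F_def
        by (intro smooth_fun_on_mult smooth_fun_on_add smooth_fun_on_const W smooth_fun_on_subset[OF \<beta>(1)]) simp
      with True \<beta>(4) W(1) show ?thesis by blast
    qed
  qed
  moreover have "v F = v f" if v: "v \<in> tangent_space A p" for v
  proof -
    have c: "smooth_near A p \<beta>" by (rule smooth_near_of_smooth_on[OF open_UNIV UNIV_I \<beta>(1)])
    have a: "smooth_near A p (\<lambda>q. f q + - f p)" by (intro smooth_near_add f smooth_near_const)
    have "v F = \<beta> p * ((1 / \<beta> p) * v (\<lambda>q. f q + - f p))"
      unfolding F_def using tv_mult[OF v c smooth_near_mult[OF smooth_near_const a, of "1 / \<beta> p"]]
      by (simp only: tv_cmult[OF v a]) simp
    then show ?thesis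
      using \<beta>(2) tv_add[OF v f smooth_near_const[of p "- f p"]] tv_const[OF v] by simp
  qed
  moreover have "F p = 0" by (simp add: F_def)
  ultimately show ?thesis using that by blast
qed

text \<open>With k = h - h(p) one has exp(h) = exp(h(p)) (1 + k g(k)). Since k(p) = 0 and g(0) = 1,
  the Leibniz rule leaves only v(k) = v(h), and the derivative of g(k) drops out.\<close>

lemma tv_exp:
  assumes v: "v \<in> tangent_space A p" and h: "smooth_near A p h"
  shows "v (\<lambda>q. exp (h q)) = exp (h p) * v h"
proof -
  obtain g :: "real \<Rightarrow> real" where g: "Cinf_on UNIV g" "g 0 = 1" "\<And>x. exp x = 1 + x * g x"
    by (rule exp_factorization) blast
  let ?k = "\<lambda>q. h q + - h p"
  have k: "smooth_near A p ?k" by (intro smooth_near_add h smooth_near_const)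
  then obtain W where W: "open W" "p \<in> W" "smooth_fun_on A W ?k" unfolding smooth_near_def by blast
  have gk: "smooth_near A p (\<lambda>q. g (?k q))"
    by (rule smooth_near_of_smooth_on[OF W(1,2) smooth_fun_on_compose[OF W(1) open_UNIV _ g(1) W(3)]]) simp
  have kg: "smooth_near A p (\<lambda>q. ?k q * g (?k q))" by (rule smooth_near_mult[OF k gk])
  have "(\<lambda>q. exp (h q)) = (\<lambda>q. exp (h p) * 1 + exp (h p) * (?k q * g (?k q)))"
    using g(3) by (metis (no_types, opaque_lifting) diff_add_cancel distrib_left exp_add add.commute
      diff_conv_add_uminus)
  then have "v (\<lambda>q. exp (h q)) = exp (h p) * v (\<lambda>q. 1) + exp (h p) * v (\<lambda>q. ?k q * g (?k q))"
    by (simp only: tv_linear[OF v smooth_near_const kg])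
  also have "v (\<lambda>q. ?k q * g (?k q)) = v ?k"
    using tv_mult[OF v k gk] g(2) by simp
  also have "v ?k = v h" using tv_add[OF v h smooth_near_const[of p "- h p"]] tv_const[OF v] by simp
  finally show ?thesis by (simp add: tv_const[OF v])
qed

lemma lincomb_tangent:
  assumes "\<And>i. v i \<in> tangent_space A p"
  shows "lincomb a v \<in> tangent_space A p"
  using assms
  by (simp add: tangent_space_def lincomb_def sum_distrib_left sum.distrib algebra_simps)

section \<open>Vector fields and Lie brackets\<close>

lemma vfield_tangent: "vfield_on A U X \<Longrightarrow> p \<in> U \<Longrightarrow> X p \<in> tangent_space A p"
  by (simp add: vfield_on_def)

lemma vfield_smooth:
  "vfield_on A U X \<Longrightarrow> open V \<Longrightarrow> V \<subseteq> U \<Longrightarrow> smooth_fun_on A V f \<Longrightarrow> smooth_fun_on A V (\<lambda>q. X q f)"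
  by (simp add: vfield_on_def)

lemma vfield_smooth_near:
  assumes "vfield_on A U X" "open U" "p \<in> U" "smooth_near A p f"
  shows "smooth_near A p (\<lambda>q. X q f)"
proof -
  obtain W where W: "open W" "p \<in> W" "smooth_fun_on A W f" using assms(4) unfolding smooth_near_def by blast
  have "smooth_fun_on A (U \<inter> W) f" by (rule smooth_fun_on_subset[OF W(3)]) simp
  then have "smooth_fun_on A (U \<inter> W) (\<lambda>q. X q f)"
    using assms(2) W(1) by (intro vfield_smooth[OF assms(1)]) auto
  with assms W show ?thesis by (intro smooth_near_of_smooth_on[of "U \<inter> W"]) auto
qed

text \<open>Tangent vectors are set to 0 on functions that are not smooth near their base point, so
  linearity at q is available only where q lies in U and both functions are smooth near q. The two
  sides are thus compared as germs, which is what \<open>tv_germ\<close> accepts.\<close>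

lemma vfield_eventually_linear:
  assumes "vfield_on A U X" "open U" "p \<in> U" "smooth_near A p f" "smooth_near A p g"
  shows "\<forall>\<^sub>F q in nhds p. a * X q f + b * X q g = X q (\<lambda>r. a * f r + b * g r)"
proof -
  have "\<forall>\<^sub>F q in nhds p. q \<in> U" using assms(2,3) by (rule eventually_nhds_in_open)
  then show ?thesis
    using smooth_near_eventually[OF assms(4)] smooth_near_eventually[OF assms(5)]
    by eventually_elim (simp add: tv_linear[OF vfield_tangent[OF assms(1)]])
qed

lemma vfield_eventually_mult:
  assumes "vfield_on A U X" "open U" "p \<in> U" "smooth_near A p f" "smooth_near A p g"
  shows "\<forall>\<^sub>F q in nhds p. X q f * g q + f q * X q g = X q (\<lambda>r. f r * g r)"
proof -
  have "\<forall>\<^sub>F q in nhds p. q \<in> U" using assms(2,3) by (rule eventually_nhds_in_open)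
  then show ?thesis
    using smooth_near_eventually[OF assms(4)] smooth_near_eventually[OF assms(5)]
    by eventually_elim (simp add: tv_mult[OF vfield_tangent[OF assms(1)]])
qed

lemma vfield_vfield_linear:
  assumes X: "v \<in> tangent_space A p"
    and Y: "vfield_on A U Y" "open U" "p \<in> U"
    and f: "smooth_near A p f" and g: "smooth_near A p g"
  shows "v (\<lambda>q. Y q (\<lambda>r. a * f r + b * g r)) = a * v (\<lambda>q. Y q f) + b * v (\<lambda>q. Y q g)"
  using tv_linear[OF X vfield_smooth_near[OF Y f] vfield_smooth_near[OF Y g]]
    tv_germ[OF X _ vfield_eventually_linear[OF Y f g, of a b]]
    smooth_near_linear[OF vfield_smooth_near[OF Y f] vfield_smooth_near[OF Y g], of a b] by simp

lemma vfield_vfield_mult: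
  assumes X: "v \<in> tangent_space A p"
    and Y: "vfield_on A U Y" "open U" "p \<in> U"
    and f: "smooth_near A p f" and g: "smooth_near A p g"
  shows "v (\<lambda>q. Y q (\<lambda>r. f r * g r)) =
    v (\<lambda>q. Y q f) * g p + Y p f * v g + v f * Y p g + f p * v (\<lambda>q. Y q g)"
proof -
  note Yf = vfield_smooth_near[OF Y f] and Yg = vfield_smooth_near[OF Y g]
  have "v (\<lambda>q. Y q (\<lambda>r. f r * g r)) = v (\<lambda>q. Y q f * g q + f q * Y q g)"
    using tv_germ[OF X _ vfield_eventually_mult[OF Y f g]]
      smooth_near_add[OF smooth_near_mult[OF Yf g] smooth_near_mult[OF f Yg]] by simp
  then show ?thesis
    by (simp add: tv_add[OF X smooth_near_mult[OF Yf g] smooth_near_mult[OF f Yg]]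
      tv_mult[OF X Yf g] tv_mult[OF X f Yg])
qed

lemma bracket_apply:
  "smooth_near A p f \<Longrightarrow> bracket A X Y p f = X p (\<lambda>q. Y q f) - Y p (\<lambda>q. X q f)"
  by (simp add: bracket_def)

text \<open>In the second derivative of a product, the mixed terms X(f) Y(g) + Y(f) X(g) are
  symmetric in the two fields and cancel in the commutator. The default value 0 in
  \<open>bracket\<close> provides extensionality.\<close>

lemma bracket_tangent:
  assumes X: "vfield_on A U X" and Y: "vfield_on A V Y" and op: "open U" "open V" "p \<in> U" "p \<in> V"
  shows "bracket A X Y p \<in> tangent_space A p"
proof -
  note Xp = vfield_tangent[OF X op(3)] and Yp = vfield_tangent[OF Y op(4)]
  have "bracket A X Y p (\<lambda>q. a * f q + b * g q) = a * bracket A X Y p f + b * bracket A X Y p g"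
    if "smooth_near A p f" "smooth_near A p g" for f g a b
    using that vfield_vfield_linear[OF Xp Y op(2,4) that] vfield_vfield_linear[OF Yp X op(1,3) that]
    by (simp add: bracket_apply smooth_near_linear algebra_simps)
  moreover have "bracket A X Y p (\<lambda>q. f q * g q) = bracket A X Y p f * g p + f p * bracket A X Y p g"
    if "smooth_near A p f" "smooth_near A p g" for f g
    using that vfield_vfield_mult[OF Xp Y op(2,4) that] vfield_vfield_mult[OF Yp X op(1,3) that]
    by (simp add: bracket_apply smooth_near_mult algebra_simps)
  ultimately show ?thesis
    unfolding tangent_space_def by (simp add: bracket_def)
qed

end

section \<open>Derivations of determinants\<close>

text \<open>The common core of a tangent vector and of \<open>deriv\<close> at a real number. One
  computation of the derivative of a determinant then serves both: along s in the definition of the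
  Lie derivative, and along a vector field on the manifold.\<close>

locale point_derivation =
  fixes F :: "('x \<Rightarrow> real) set" and v :: "('x \<Rightarrow> real) \<Rightarrow> real" and p :: 'x
  assumes const: "(\<lambda>x. c) \<in> F"
    and add: "f \<in> F \<Longrightarrow> g \<in> F \<Longrightarrow> (\<lambda>x. f x + g x) \<in> F"
    and mult: "f \<in> F \<Longrightarrow> g \<in> F \<Longrightarrow> (\<lambda>x. f x * g x) \<in> F"
    and D_const: "v (\<lambda>x. c) = 0"
    and D_add: "f \<in> F \<Longrightarrow> g \<in> F \<Longrightarrow> v (\<lambda>x. f x + g x) = v f + v g"
    and D_mult: "f \<in> F \<Longrightarrow> g \<in> F \<Longrightarrow> v (\<lambda>x. f x * g x) = v f * g p + f p * v g"
begin

lemma sum: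
  assumes "\<And>i. i \<in> I \<Longrightarrow> f i \<in> F"
  shows "(\<lambda>x. \<Sum>i\<in>I. f i x) \<in> F" and "v (\<lambda>x. \<Sum>i\<in>I. f i x) = (\<Sum>i\<in>I. v (f i))"
proof -
  have "(\<lambda>x. \<Sum>i\<in>I. f i x) \<in> F \<and> v (\<lambda>x. \<Sum>i\<in>I. f i x) = (\<Sum>i\<in>I. v (f i))"
    using assms
  proof (induction I rule: infinite_finite_induct)
    case (insert i I)
    then show ?case using add[of "f i" "\<lambda>x. \<Sum>i\<in>I. f i x"] D_add[of "f i" "\<lambda>x. \<Sum>i\<in>I. f i x"] by simp
  qed (simp_all add: const D_const)
  then show "(\<lambda>x. \<Sum>i\<in>I. f i x) \<in> F" "v (\<lambda>x. \<Sum>i\<in>I. f i x) = (\<Sum>i\<in>I. v (f i))" by auto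
qed

lemma prod:
  assumes "finite I" "\<And>i. i \<in> I \<Longrightarrow> f i \<in> F"
  shows "(\<lambda>x. \<Prod>i\<in>I. f i x) \<in> F"
    and "v (\<lambda>x. \<Prod>i\<in>I. f i x) = (\<Sum>i\<in>I. v (f i) * (\<Prod>j\<in>I - {i}. f j p))"
proof -
  have "(\<lambda>x. \<Prod>i\<in>I. f i x) \<in> F \<and>
      v (\<lambda>x. \<Prod>i\<in>I. f i x) = (\<Sum>i\<in>I. v (f i) * (\<Prod>j\<in>I - {i}. f j p))"
    using assms
  proof (induction I rule: finite_induct)
    case (insert k I)
    then have IH: "(\<lambda>x. \<Prod>i\<in>I. f i x) \<in> F"
      "v (\<lambda>x. \<Prod>i\<in>I. f i x) = (\<Sum>i\<in>I. v (f i) * (\<Prod>j\<in>I - {i}. f j p))" by auto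
    have "(\<Prod>j\<in>insert k I - {i}. f j p) = f k p * (\<Prod>j\<in>I - {i}. f j p)" if "i \<in> I" for i
    proof -
      have "insert k I - {i} = insert k (I - {i})" using that insert.hyps by auto
      then show ?thesis using insert.hyps by simp
    qed
    then have "(\<Sum>i\<in>I. v (f i) * (\<Prod>j\<in>insert k I - {i}. f j p))
        = f k p * (\<Sum>i\<in>I. v (f i) * (\<Prod>j\<in>I - {i}. f j p))"
      by (simp add: sum_distrib_left mult_ac)
    moreover have "insert k I - {k} = I" using insert.hyps by auto
    ultimately show ?case
      using insert.hyps insert.prems IH mult[of "f k" "\<lambda>x. \<Prod>i\<in>I. f i x"] D_mult[of "f k" "\<lambda>x. \<Prod>i\<in>I. f i x"]
      by simp
  qed (simp_all add: const D_const)
  then show "(\<lambda>x. \<Prod>i\<in>I. f i x) \<in> F"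
    "v (\<lambda>x. \<Prod>i\<in>I. f i x) = (\<Sum>i\<in>I. v (f i) * (\<Prod>j\<in>I - {i}. f j p))" by auto
qed

lemma det_mem:
  fixes B :: "'x \<Rightarrow> real ^ 'n ^ 'n"
  assumes "\<And>i j. (\<lambda>x. B x $ i $ j) \<in> F"
  shows "(\<lambda>x. det (B x)) \<in> F"
  unfolding det_def by (intro sum(1) mult const prod(1) assms) simp

text \<open>Jacobi's formula at the identity matrix. A permutation other than the identity moves at
  least two indices, so after one factor of its product is differentiated, an off-diagonal zero is
  still left; only the diagonal product contributes.\<close>

lemma det_deriv:
  fixes B :: "'x \<Rightarrow> real ^ 'n ^ 'n"
  assumes B: "\<And>i j. (\<lambda>x. B x $ i $ j) \<in> F" and Bp: "B p = mat 1"
  shows "v (\<lambda>x. det (B x)) = (\<Sum>i\<in>UNIV. v (\<lambda>x. B x $ i $ i))"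
proof -
  let ?P = "{\<pi>. \<pi> permutes (UNIV :: 'n set)}"
  define m where "m \<pi> = (\<lambda>x. of_int (sign \<pi>) * (\<Prod>i\<in>UNIV. B x $ i $ \<pi> i))" for \<pi> :: "'n \<Rightarrow> 'n"
  have pr: "(\<lambda>x. \<Prod>i\<in>UNIV. B x $ i $ \<pi> i) \<in> F" for \<pi> :: "'n \<Rightarrow> 'n" by (intro prod(1) B) simp
  have vm: "v (m \<pi>) = of_int (sign \<pi>) *
      (\<Sum>i\<in>UNIV. v (\<lambda>x. B x $ i $ \<pi> i) * (\<Prod>j\<in>UNIV - {i}. B p $ j $ \<pi> j))" for \<pi> :: "'n \<Rightarrow> 'n"
    unfolding m_def using D_mult[OF const pr] prod(2)[of UNIV "\<lambda>i x. B x $ i $ \<pi> i"] B D_const by simp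
  have "v (m \<pi>) = 0" if "\<pi> \<in> ?P - {id}" for \<pi>
  proof -
    have "(\<Prod>j\<in>UNIV - {i}. B p $ j $ \<pi> j) = 0" for i
    proof -
      have "\<exists>j. j \<noteq> i \<and> \<pi> j \<noteq> j"
      proof (rule ccontr)
        assume "\<not> ?thesis"
        then have fx: "\<pi> j = j" if "j \<noteq> i" for j using that by blast
        have "inj \<pi>" using that permutes_inj by blast
        then have "\<pi> i = i" using fx by (metis injD)
        with fx have "\<pi> = id" by (metis eq_id_iff)
        with that show False by simp
      qed
      then obtain j where "j \<noteq> i" "\<pi> j \<noteq> j" by blast
      then show ?thesis unfolding Bp by (intro prod_zero bexI[of _ j]) (auto simp: mat_def)
    qed
    then show ?thesis by (simp only: vm mult_zero_right sum.neutral_const)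
  qed
  moreover have "v (m id) = (\<Sum>i\<in>UNIV. v (\<lambda>x. B x $ i $ i))"
    unfolding vm Bp by (simp add: mat_def sign_id)
  moreover have "v (\<lambda>x. det (B x)) = (\<Sum>\<pi>\<in>?P. v (m \<pi>))"
    unfolding det_def m_def by (intro sum(2) mult const pr)
  moreover have "(\<Sum>\<pi>\<in>?P. v (m \<pi>)) = v (m id) + (\<Sum>\<pi>\<in>?P - {id}. v (m \<pi>))"
    by (rule sum.remove) (simp_all add: finite_permutations permutes_id)
  ultimately show ?thesis by simp
qed

end

lemma point_derivation_deriv:
  "point_derivation {f. f field_differentiable (at (t::real))} (\<lambda>f. deriv f t) t"
  by unfold_locales (auto intro: field_differentiable_add field_differentiable_mult)

section \<open>Divergence\<close>

context smooth_mfd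
begin

lemma point_derivation_tangent:
  "v \<in> tangent_space A p \<Longrightarrow> point_derivation {f. smooth_near A p f} v p"
  by unfold_locales (auto simp: smooth_near_const smooth_near_add smooth_near_mult tv_const tv_add tv_mult)

section \<open>Functions dual to a basis of the tangent space\<close>

lemma zero_tangent: "(\<lambda>f. 0) \<in> tangent_space A p"
  by (simp add: tangent_space_def)

text \<open>The vectors (v_i(f))_i, for f smooth near p, form a subspace. Were it proper, a nonzero
  vector orthogonal to it would be a linear relation among the v_i, contradicting uniqueness of the
  coordinates of 0. So every unit vector is attained. This replaces coordinate functions.\<close>

lemma dual_functions:
  assumes v: "is_basis (tangent_space A p) (v :: 'i::finite \<Rightarrow> 'm tvec)"
  obtains f where "\<And>j. smooth_near A p (f j)" "\<And>i j. v i (f j) = (if i = j then 1 else 0)"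
proof -
  define ev where "ev f = (\<chi> i. v i f)" for f
  have vT: "v i \<in> tangent_space A p" for i using v unfolding is_basis_def by blast
  let ?S = "ev ` {f. smooth_near A p f}"
  have "subspace ?S"
  proof (rule subspaceI)
    have "ev (\<lambda>q. 0) = 0" by (simp add: ev_def vec_eq_iff tv_const[OF vT])
    then show "0 \<in> ?S" using smooth_near_const[of p 0] by (metis image_eqI mem_Collect_eq)
  next
    fix x y assume "x \<in> ?S" "y \<in> ?S"
    then obtain f g where f: "smooth_near A p f" "x = ev f" and g: "smooth_near A p g" "y = ev g" by blast
    then have "x + y = ev (\<lambda>q. f q + g q)" by (simp add: ev_def vec_eq_iff tv_add[OF vT])
    then show "x + y \<in> ?S" using smooth_near_add[OF f(1) g(1)] by blast
  next
    fix c x assume "x \<in> ?S"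
    then obtain f where f: "smooth_near A p f" "x = ev f" by blast
    then have "c *\<^sub>R x = ev (\<lambda>q. c * f q)" by (simp add: ev_def vec_eq_iff tv_cmult[OF vT])
    then show "c *\<^sub>R x \<in> ?S" using smooth_near_mult[OF smooth_near_const f(1)] by blast
  qed
  then have sp: "span ?S = ?S" by simp
  have "?S = UNIV"
  proof (rule ccontr)
    assume "?S \<noteq> UNIV"
    then obtain a where a: "a \<noteq> 0" "\<And>x. x \<in> ?S \<Longrightarrow> a \<bullet> x = 0"
      using span_not_UNIV_orthogonal[of ?S] sp by auto
    \<comment> \<open>Extensionality extends the relation from smooth functions to all functions, so
      that it becomes an equation between tangent vectors.\<close>
    have "(\<Sum>i\<in>UNIV. a $ i * v i f) = 0" for f
    proof (cases "smooth_near A p f")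
      case True
      with a(2)[of "ev f"] show ?thesis by (simp add: inner_vec_def ev_def)
    next
      case False
      then show ?thesis by (simp add: tv_ext[OF vT])
    qed
    then have "(\<lambda>f. 0) = lincomb (\<lambda>i. a $ i) v" "(\<lambda>f. 0) = lincomb (\<lambda>i. 0) v" by (auto simp: lincomb_def)
    moreover have "\<exists>!a. (\<lambda>f. 0) = lincomb a v" using v zero_tangent unfolding is_basis_def by blast
    ultimately have "(\<lambda>i. a $ i) = (\<lambda>i. 0)" by blast
    then show False using a(1) by (auto simp: vec_eq_iff dest: fun_cong)
  qed
  then have "\<exists>g. smooth_near A p g \<and> ev g = axis j 1" for j by (metis UNIV_I imageE mem_Collect_eq)
  then obtain f where f: "\<And>j. smooth_near A p (f j)" "\<And>j. ev (f j) = axis j 1" by metis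
  have "v i (f j) = (if i = j then 1 else 0)" for i j
    using f(2)[of j] by (auto simp: ev_def vec_eq_iff axis_def)
  with f(1) show ?thesis by (rule that)
qed

lemma dual_expansion:
  assumes "is_basis (tangent_space A p) v" "\<And>i j. v i (f j) = (if i = j then 1 else 0)"
    and "w \<in> tangent_space A p"
  shows "w = lincomb (\<lambda>i. w (f i)) v"
proof -
  obtain a where a: "w = lincomb a v" using assms(1,3) unfolding is_basis_def by blast
  have "w (f i) = a i" for i unfolding a lincomb_def assms(2) by (simp add: if_distrib cong: if_cong)
  then show ?thesis using a by simp
qed

section \<open>Densities and their Lie derivatives\<close>

lemma density_lincomb:
  "is_density A \<omega> \<Longrightarrow> (\<And>i. v i \<in> tangent_space A p) \<Longrightarrow>
    \<omega> p (\<lambda>i. lincomb (\<lambda>j. B $ i $ j) v) = \<bar>det B\<bar> * \<omega> p v"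
  by (simp add: is_density_def)

lemma density_pos: "is_density A \<omega> \<Longrightarrow> is_basis (tangent_space A p) v \<Longrightarrow> \<omega> p v > 0"
  by (simp add: is_density_def)

lemma density_smooth:
  "is_density A \<omega> \<Longrightarrow> open U \<Longrightarrow> frame_on A U Y \<Longrightarrow> smooth_fun_on A U (\<lambda>p. \<omega> p (\<lambda>i. Y i p))"
  by (simp add: is_density_def)

lemma frame_vfield: "frame_on A U Y \<Longrightarrow> vfield_on A U (Y i)"
  by (simp add: frame_on_def)

lemma frame_basis: "frame_on A U Y \<Longrightarrow> p \<in> U \<Longrightarrow> is_basis (tangent_space A p) (\<lambda>i. Y i p)"
  by (simp add: frame_on_def)

lemma is_density_scale:
  assumes "is_density A \<omega>" "smooth_fun_on A UNIV u" "\<And>p. u p > 0"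
  shows "is_density A (scale_density u \<omega>)"
  unfolding is_density_def scale_density_def
proof (intro conjI allI impI)
  fix p and v :: "'n \<Rightarrow> 'm tvec" and B :: "real ^ 'n ^ 'n"
  assume "\<forall>i. v i \<in> tangent_space A p"
  then show "u p * \<omega> p (\<lambda>i. lincomb (\<lambda>j. B $ i $ j) v) = \<bar>det B\<bar> * (u p * \<omega> p v)"
    by (simp add: density_lincomb[OF assms(1)])
next
  fix p and v :: "'n \<Rightarrow> 'm tvec" assume "is_basis (tangent_space A p) v"
  then show "0 < u p * \<omega> p v" using density_pos[OF assms(1)] assms(3) by simp
next
  fix U and Y :: "'n \<Rightarrow> 'm vfield" assume "open U" "frame_on A U Y"
  then show "smooth_fun_on A U (\<lambda>p. u p * \<omega> p (\<lambda>i. Y i p))"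
    by (intro smooth_fun_on_mult smooth_fun_on_subset[OF assms(2)] density_smooth[OF assms(1)] subset_UNIV)
qed

text \<open>Let C be the matrix of the brackets in the frame at p. The displaced frame is 1 + sC
  applied to the frame, so the density is multiplied by |det(1 + sC)|, whose derivative at s = 0 is
  the trace of C; the dual functions read off its diagonal.\<close>

lemma lie_deriv_density_eq:
  assumes \<omega>: "is_density A \<omega>" and X: "vfield_on A UNIV X"
    and Y: "frame_on A U Y" "open U" "p \<in> U"
    and f: "\<And>i j. Y i p (f j) = (if i = j then 1 else 0)"
  shows "lie_deriv_density A X \<omega> Y p =
    X p (\<lambda>q. \<omega> q (\<lambda>i. Y i q)) - (\<Sum>i\<in>UNIV. bracket A X (Y i) p (f i)) * \<omega> p (\<lambda>i. Y i p)"
proof -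
  let ?Y = "\<lambda>i. Y i p"
  have basis: "is_basis (tangent_space A p) ?Y" by (rule frame_basis[OF Y(1,3)])
  have YT: "?Y i \<in> tangent_space A p" for i by (rule vfield_tangent[OF frame_vfield[OF Y(1)] Y(3)])
  define C where "C i j = bracket A X (Y i) p (f j)" for i j
  have br: "bracket A X (Y i) p = lincomb (C i) ?Y" for i
    unfolding C_def
    by (rule dual_expansion[OF basis f bracket_tangent[OF X frame_vfield[OF Y(1)] open_UNIV Y(2) UNIV_I Y(3)]])
  define M where "M s = (\<chi> i j. (if i = j then 1 else 0) + s * C i j)" for s :: real
  have "(\<lambda>g. Y i p g + s * bracket A X (Y i) p g) = lincomb (\<lambda>j. M s $ i $ j) ?Y" for i s
    unfolding br M_def lincomb_def
    by (simp add: fun_eq_iff distrib_right sum.distrib sum_distrib_left mult.assoc if_distrib[of "\<lambda>x. x * _"] cong: if_cong)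
  then have dens: "\<omega> p (\<lambda>i g. Y i p g + s * bracket A X (Y i) p g) = \<bar>det (M s)\<bar> * \<omega> p ?Y" for s
    using density_lincomb[OF \<omega> YT] by simp
  interpret D: point_derivation "{f. f field_differentiable (at (0::real))}" "\<lambda>f. deriv f 0" 0
    by (rule point_derivation_deriv)
  have entry: "((\<lambda>s. M s $ i $ j) has_real_derivative C i j) (at 0)" for i j
    unfolding M_def by (auto intro!: derivative_eq_intros)
  then have M: "(\<lambda>s. M s $ i $ j) \<in> {f. f field_differentiable (at 0)}" for i j
    by (auto simp: field_differentiable_def)
  have M0: "M 0 = mat 1" by (simp add: M_def mat_def vec_eq_iff)
  have "deriv (\<lambda>s. det (M s)) 0 = (\<Sum>i\<in>UNIV. C i i)"
    unfolding D.det_deriv[OF M M0] DERIV_imp_deriv[OF entry] ..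
  then have det: "((\<lambda>s. det (M s)) has_real_derivative (\<Sum>i\<in>UNIV. C i i)) (at 0)"
    using D.det_mem[OF M] DERIV_deriv_iff_field_differentiable by force
  have "\<forall>\<^sub>F s in nhds 0. det (M s) > 0"
    using DERIV_isCont[OF det] M0
    by (intro order_tendstoD) (auto simp: isCont_def tendsto_nhds_iff)
  then have ev: "\<forall>\<^sub>F s in nhds 0. \<bar>det (M s)\<bar> = det (M s)" by eventually_elim simp
  have "((\<lambda>s. \<bar>det (M s)\<bar>) has_real_derivative (\<Sum>i\<in>UNIV. C i i)) (at 0)"
    using DERIV_cong_ev[OF refl ev refl] det by blast
  then have "((\<lambda>s. \<bar>det (M s)\<bar> * \<omega> p ?Y) has_real_derivative (\<Sum>i\<in>UNIV. C i i) * \<omega> p ?Y) (at 0)"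
    by (rule DERIV_cmult_right)
  then show ?thesis
    unfolding lie_deriv_density_def dens C_def by (simp add: DERIV_imp_deriv)
qed

text \<open>The matrices \<open>G\<close> and \<open>G'\<close> of the two frames applied to the functions \<open>f\<close> satisfy
  \<open>\<omega>(Y') \<bar>det G\<bar> = \<bar>det G'\<bar> \<omega>(Y)\<close>; differentiating this smooth identity avoids differentiating the
  transition matrix between the frames, whose smoothness is not known at this point.\<close>
lemma lie_deriv_frame_change:
  assumes \<omega>: "is_density A \<omega>" and X: "vfield_on A UNIV X"
    and Y: "frame_on A U Y" "open U" "p \<in> U"
    and Y': "frame_on A U' Y'" "open U'" "p \<in> U'"
  shows "lie_deriv_density A X \<omega> Y' p * \<omega> p (\<lambda>i. Y i p) = lie_deriv_density A X \<omega> Y p * \<omega> p (\<lambda>i. Y' i p)"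
proof -
  note YV = frame_vfield[OF Y(1)] and YV' = frame_vfield[OF Y'(1)]
  note YT = vfield_tangent[OF YV Y(3)] and YT' = vfield_tangent[OF YV' Y'(3)]
  have XT: "X p \<in> tangent_space A p" by (rule vfield_tangent[OF X UNIV_I])
  interpret D: point_derivation "{f. smooth_near A p f}" "X p" p by (rule point_derivation_tangent[OF XT])
  obtain f where f: "\<And>j. smooth_near A p (f j)" "\<And>i j. Y i p (f j) = (if i = j then 1 else 0)"
    by (rule dual_functions[OF frame_basis[OF Y(1,3)]]) blast
  define G where "G q = (\<chi> i j. Y i q (f j))" for q
  define G' where "G' q = (\<chi> i j. Y' i q (f j))" for q
  have Gp: "G p = mat 1" by (simp add: G_def mat_def vec_eq_iff f(2))
  have G: "(\<lambda>q. G q $ i $ j) \<in> {f. smooth_near A p f}" for i j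
    using vfield_smooth_near[OF YV Y(2,3) f(1)] by (simp add: G_def)
  have G': "(\<lambda>q. G' q $ i $ j) \<in> {f. smooth_near A p f}" for i j
    using vfield_smooth_near[OF YV' Y'(2,3) f(1)] by (simp add: G'_def)
  have dG: "smooth_near A p (\<lambda>q. det (G q))" and dG': "smooth_near A p (\<lambda>q. det (G' q))"
    using D.det_mem[OF G] D.det_mem[OF G'] by simp_all

  have "\<exists>a. Y l p = lincomb a (\<lambda>i. Y' i p)" for l
    using frame_basis[OF Y'(1,3)] YT unfolding is_basis_def by blast
  then obtain b where b: "\<And>l. Y l p = lincomb (b l) (\<lambda>i. Y' i p)" by metis
  \<comment> \<open>N expresses Y through Y' at the single point p and is kept constant; it is the
    inverse of G'(p).\<close>
  define N where "N = (\<chi> l i. b l i)"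
  have YN: "Y l p g = (\<Sum>i\<in>UNIV. N $ l $ i * Y' i p g)" for l g
    unfolding b by (simp add: lincomb_def N_def)
  have "N ** G' p = mat 1"
    by (simp add: vec_eq_iff matrix_matrix_mult_def G'_def YN[symmetric] f(2) mat_def)
  then have GN: "G' p ** N = mat 1" by (simp add: matrix_left_right_inverse)
  then have detN: "det (G' p) * det N = 1" using det_mul[of "G' p" N] by simp
  \<comment> \<open>Recombining the f_l with constant coefficients gives functions dual to Y' at p,
    so \<open>lie_deriv_density_eq\<close> applies to Y' as well.\<close>
  define f' where "f' j = (\<lambda>q. \<Sum>l\<in>UNIV. N $ l $ j * f l q)" for j
  have Nf: "smooth_near A p (\<lambda>q. N $ l $ j * f l q)" for l j by (intro smooth_near_mult smooth_near_const f(1))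
  have tv_f': "v (f' j) = (\<Sum>l\<in>UNIV. N $ l $ j * v (f l))"
    if "v \<in> tangent_space A q" "\<And>l. smooth_near A q (f l)" for v q j
    unfolding f'_def using that(2)
    by (simp add: tv_sum[OF that(1)] smooth_near_mult smooth_near_const tv_cmult[OF that(1)])
  have f': "smooth_near A p (f' j)" for j unfolding f'_def by (intro smooth_near_sum Nf)
  have ev_f: "\<forall>\<^sub>F q in nhds p. \<forall>l. smooth_near A q (f l)"
    by (rule eventually_all_finite) (rule smooth_near_eventually[OF f(1)])
  have ev_U: "\<forall>\<^sub>F q in nhds p. q \<in> U" "\<forall>\<^sub>F q in nhds p. q \<in> U'"
    using Y(2,3) Y'(2,3) by (auto intro: eventually_nhds_in_open)
  \<comment> \<open>H = G' N near p and H(p) = 1. Hence \<open>det_deriv\<close> applies to H, and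
    its determinant is a constant multiple of det G'.\<close>
  define H where "H q = (\<chi> i j. Y' i q (f' j))" for q
  have H: "(\<lambda>q. H q $ i $ j) \<in> {f. smooth_near A p f}" for i j
    using vfield_smooth_near[OF YV' Y'(2,3) f'] by (simp add: H_def)
  have ev_H: "\<forall>\<^sub>F q in nhds p. H q = G' q ** N"
    using ev_f ev_U(2)
  proof eventually_elim
    case (elim q)
    have "Y' i q (f' j) = (\<Sum>l\<in>UNIV. N $ l $ j * Y' i q (f l))" for i j
      using elim by (intro tv_f'[OF vfield_tangent[OF YV']]) auto
    then show ?case by (simp add: H_def G'_def matrix_matrix_mult_def vec_eq_iff mult.commute)
  qed
  then have Hp: "H p = mat 1" using GN eventually_nhds_x_imp_x by force
  then have f'_dual: "Y' i p (f' j) = (if i = j then 1 else 0)" for i j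
    by (simp add: H_def mat_def vec_eq_iff)

  define w where "w = \<omega> p (\<lambda>i. Y i p)"
  define w' where "w' = \<omega> p (\<lambda>i. Y' i p)"
  define a where "a = X p (\<lambda>q. \<omega> q (\<lambda>i. Y i q))"
  define a' where "a' = X p (\<lambda>q. \<omega> q (\<lambda>i. Y' i q))"
  define XG where "XG = X p (\<lambda>q. det (G q))"
  define XG' where "XG' = X p (\<lambda>q. det (G' q))"
  \<comment> \<open>The part of the bracket sums in which X acts first. It is the same number for
    both frames, because the coefficients N in \<open>f'\<close> recombine Y' into Y at p.\<close>
  define E where "E = (\<Sum>i\<in>UNIV. Y i p (\<lambda>q. X q (f i)))"
  \<comment> \<open>The determinants of G and G' are nonzero at p and keep their signs nearby. The
    constant sign of det G' therefore replaces the absolute values, which leaves an identity of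
    smooth functions that X can differentiate.\<close>
  define \<epsilon> where "\<epsilon> = sgn (det (G' p))"

  have "lie_deriv_density A X \<omega> Y p = a - (\<Sum>i\<in>UNIV. bracket A X (Y i) p (f i)) * w"
    unfolding a_def w_def by (rule lie_deriv_density_eq[OF \<omega> X Y f(2)])
  moreover have "XG = (\<Sum>i\<in>UNIV. X p (\<lambda>q. Y i q (f i)))"
    unfolding XG_def D.det_deriv[OF G Gp] by (simp add: G_def)
  ultimately have lie: "lie_deriv_density A X \<omega> Y p = a - (XG - E) * w"
    by (simp add: bracket_apply f(1) sum_subtractf E_def)

  have "lie_deriv_density A X \<omega> Y' p = a' - (\<Sum>i\<in>UNIV. bracket A X (Y' i) p (f' i)) * w'"
    unfolding a'_def w'_def by (rule lie_deriv_density_eq[OF \<omega> X Y' f'_dual])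
  moreover have "(\<Sum>i\<in>UNIV. X p (\<lambda>q. Y' i q (f' i))) = det N * XG'"
  proof -
    have "(\<Sum>i\<in>UNIV. X p (\<lambda>q. Y' i q (f' i))) = X p (\<lambda>q. det (H q))"
      unfolding D.det_deriv[OF H Hp] by (simp add: H_def)
    also have "\<dots> = X p (\<lambda>q. det N * det (G' q))"
      using D.det_mem[OF H] ev_H
      by (intro tv_germ[OF XT]) (auto elim!: eventually_mono simp: det_mul)
    also have "\<dots> = det N * XG'" unfolding XG'_def by (rule tv_cmult[OF XT dG'])
    finally show ?thesis .
  qed
  moreover have "(\<Sum>i\<in>UNIV. Y' i p (\<lambda>q. X q (f' i))) = E"
  proof -
    have Xf: "smooth_near A p (\<lambda>q. X q (f l))" for l by (rule vfield_smooth_near[OF X open_UNIV UNIV_I f(1)])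
    have "Y' i p (\<lambda>q. X q (f' i)) = (\<Sum>l\<in>UNIV. N $ l $ i * Y' i p (\<lambda>q. X q (f l)))" for i
    proof -
      have "\<forall>\<^sub>F q in nhds p. X q (f' i) = (\<Sum>l\<in>UNIV. N $ l $ i * X q (f l))"
        using ev_f by eventually_elim (auto intro: tv_f' vfield_tangent[OF X])
      then have "Y' i p (\<lambda>q. X q (f' i)) = Y' i p (\<lambda>q. \<Sum>l\<in>UNIV. N $ l $ i * X q (f l))"
        by (intro tv_germ[OF YT'] vfield_smooth_near[OF X open_UNIV UNIV_I f'])
      then show ?thesis
        by (simp add: tv_sum[OF YT'] smooth_near_mult smooth_near_const Xf tv_cmult[OF YT' Xf])
    qed
    then have "(\<Sum>i\<in>UNIV. Y' i p (\<lambda>q. X q (f' i)))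
        = (\<Sum>i\<in>UNIV. \<Sum>l\<in>UNIV. N $ l $ i * Y' i p (\<lambda>q. X q (f l)))" by simp
    also have "\<dots> = E" unfolding E_def YN by (rule sum.swap)
    finally show ?thesis .
  qed
  ultimately have lie': "lie_deriv_density A X \<omega> Y' p = a' - (det N * XG' - E) * w'"
    by (simp add: bracket_apply f' sum_subtractf)

  have dens: "\<omega> q (\<lambda>i. Y' i q) * \<bar>det (G q)\<bar> = \<bar>det (G' q)\<bar> * \<omega> q (\<lambda>i. Y i q)"
    if q: "q \<in> U" "q \<in> U'" for q
  proof -
    have "\<exists>a. Y' i q = lincomb a (\<lambda>j. Y j q)" for i
      using frame_basis[OF Y(1) q(1)] vfield_tangent[OF YV' q(2)] unfolding is_basis_def by blast
    then obtain c where c: "\<And>i. Y' i q = lincomb (c i) (\<lambda>j. Y j q)" by metis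
    define B where "B = (\<chi> i j. c i j)"
    have "\<omega> q (\<lambda>i. Y' i q) = \<omega> q (\<lambda>i. lincomb (\<lambda>j. B $ i $ j) (\<lambda>j. Y j q))"
      unfolding c by (simp add: B_def)
    also have "\<dots> = \<bar>det B\<bar> * \<omega> q (\<lambda>i. Y i q)"
      by (rule density_lincomb[OF \<omega> vfield_tangent[OF YV q(1)]])
    moreover have "G' q = B ** G q"
      by (simp add: G_def G'_def B_def c lincomb_def matrix_matrix_mult_def vec_eq_iff)
    ultimately show ?thesis by (simp add: det_mul abs_mult)
  qed
  have d0: "det (G' p) \<noteq> 0" using detN by auto
  have w': "w' = \<epsilon> * det (G' p) * w"
    using dens[OF Y(3) Y'(3)] unfolding w_def w'_def \<epsilon>_def Gp by (simp add: sgn_mult_self_eq abs_sgn mult.commute)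
  have "((\<lambda>q. det (G q)) \<longlongrightarrow> det (G p)) (nhds p)" "((\<lambda>q. det (G' q)) \<longlongrightarrow> det (G' p)) (nhds p)"
    using smooth_near_continuous[OF dG] smooth_near_continuous[OF dG']
      tendsto_at_iff_tendsto_nhds[of "\<lambda>q. det (G q)" p] tendsto_at_iff_tendsto_nhds[of "\<lambda>q. det (G' q)" p]
    unfolding isCont_def by blast+
  then have "\<forall>\<^sub>F q in nhds p. 0 < det (G q)" "\<forall>\<^sub>F q in nhds p. 0 < det (G' q) * det (G' p)"
    using order_tendstoD(1)[of "\<lambda>q. det (G q)" "det (G p)" "nhds p" 0]
      order_tendstoD(1)[OF tendsto_mult_right[of "\<lambda>q. det (G' q)" "det (G' p)" "nhds p" "det (G' p)"], of 0] d0 Gp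
    by (simp_all add: zero_less_mult_iff linorder_neq_iff disj_commute)
  then have "\<forall>\<^sub>F q in nhds p. \<omega> q (\<lambda>i. Y' i q) * det (G q) = \<epsilon> * (det (G' q) * \<omega> q (\<lambda>i. Y i q))"
    using ev_U
  proof eventually_elim
    case (elim q)
    then have "\<bar>det (G' q)\<bar> = \<epsilon> * det (G' q)"
      by (auto simp: \<epsilon>_def zero_less_mult_iff)
    with dens[OF elim(3,4)] elim(1) show ?case by simp
  qed
  moreover have oY: "smooth_near A p (\<lambda>q. \<omega> q (\<lambda>i. Y i q))"
    by (rule smooth_near_of_smooth_on[OF Y(2,3) density_smooth[OF \<omega> Y(2,1)]])
  moreover have oY': "smooth_near A p (\<lambda>q. \<omega> q (\<lambda>i. Y' i q))"
    by (rule smooth_near_of_smooth_on[OF Y'(2,3) density_smooth[OF \<omega> Y'(2,1)]])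
  ultimately have "X p (\<lambda>q. \<omega> q (\<lambda>i. Y' i q) * det (G q)) = X p (\<lambda>q. \<epsilon> * (det (G' q) * \<omega> q (\<lambda>i. Y i q)))"
    by (intro tv_germ[OF XT] smooth_near_mult dG)
  then have "a' * det (G p) + w' * XG = \<epsilon> * (XG' * w + det (G' p) * a)"
    unfolding tv_mult[OF XT oY' dG] tv_cmult[OF XT smooth_near_mult[OF dG' oY]] tv_mult[OF XT dG' oY]
    by (simp only: a_def a'_def w_def w'_def XG_def XG'_def)
  then have a': "a' = \<epsilon> * (XG' * w + det (G' p) * a) - w' * XG" by (simp add: Gp)
  \<comment> \<open>The first summand collects the terms with X(det G'). It vanishes because N is
    inverse to G'(p), and the rest is the claim.\<close>
  have "(a' - (det N * XG' - E) * w') * w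
      = \<epsilon> * XG' * w * w * (1 - det (G' p) * det N) + (a - (XG - E) * w) * w'"
    unfolding a' w' by (simp add: algebra_simps)
  then show ?thesis unfolding lie lie' w_def[symmetric] w'_def[symmetric] by (simp add: detN)
qed

text \<open>This discharges the definite description: \<open>lie_deriv_frame_change\<close> makes
  the quotient by the density the same for all frames, and the frame Y, on which the density is
  positive, determines it.\<close>

lemma divergence_eq:
  assumes \<omega>: "is_density A \<omega>" and X: "vfield_on A UNIV X"
    and Y: "frame_on A U Y" "open U" "p \<in> U"
  shows "lie_deriv_density A X \<omega> Y p = divergence A \<omega> X p * \<omega> p (\<lambda>i. Y i p)"
proof -
  let ?P = "\<lambda>r. \<forall>U Y. open U \<longrightarrow> p \<in> U \<longrightarrow> frame_on A U Y \<longrightarrow>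
    lie_deriv_density A X \<omega> Y p = r * \<omega> p (\<lambda>i. Y i p)"
  have pos: "\<omega> p (\<lambda>i. Y i p) > 0" by (rule density_pos[OF \<omega> frame_basis[OF Y(1,3)]])
  have "?P (lie_deriv_density A X \<omega> Y p / \<omega> p (\<lambda>i. Y i p))"
    using lie_deriv_frame_change[OF \<omega> X Y] pos by (auto simp: field_simps)
  moreover have "r = lie_deriv_density A X \<omega> Y p / \<omega> p (\<lambda>i. Y i p)" if "?P r" for r
  proof -
    have "lie_deriv_density A X \<omega> Y p = r * \<omega> p (\<lambda>i. Y i p)" using that Y by blast
    then show ?thesis using pos by simp
  qed
  ultimately have "divergence A \<omega> X p = lie_deriv_density A X \<omega> Y p / \<omega> p (\<lambda>i. Y i p)"
    unfolding divergence_def by (rule the_equality)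
  then show ?thesis using pos by simp
qed

lemma divergence_frame:
  assumes \<omega>: "is_density A \<omega>" and X: "vfield_on A UNIV X"
    and Y: "frame_on A U Y" "open U" "p \<in> U"
    and f: "\<And>i j. Y i p (f j) = (if i = j then 1 else 0)"
  shows "divergence A \<omega> X p =
    X p (\<lambda>q. \<omega> q (\<lambda>i. Y i q)) / \<omega> p (\<lambda>i. Y i p) - (\<Sum>i\<in>UNIV. bracket A X (Y i) p (f i))"
proof -
  have "\<omega> p (\<lambda>i. Y i p) > 0" by (rule density_pos[OF \<omega> frame_basis[OF Y(1,3)]])
  then show ?thesis
    using divergence_eq[OF \<omega> X Y] unfolding lie_deriv_density_eq[OF \<omega> X Y f] by (simp add: field_simps)
qed

text \<open>From [aX, Y_i] = a [X, Y_i] - Y_i(a) X, the extra trace term is the sum of Y_i(a)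
  X(f_i), which is X(a) by expanding X in the frame. Two summands are treated together because a
  rotated field has this form.\<close>

lemma divergence_combination:
  assumes \<omega>: "is_density A \<omega>" and X: "vfield_on A UNIV X" and X': "vfield_on A UNIV X'"
    and a: "smooth_fun_on A UNIV a" and b: "smooth_fun_on A UNIV b"
    and Z: "vfield_on A UNIV Z" "\<And>q. Z q = (\<lambda>f. a q * X q f + b q * X' q f)"
    and Y: "frame_on A U Y" "open U" "p \<in> U"
  shows "divergence A \<omega> Z p =
    a p * divergence A \<omega> X p + X p a + b p * divergence A \<omega> X' p + X' p b"
proof -
  obtain f where f: "\<And>j. smooth_near A p (f j)" "\<And>i j. Y i p (f j) = (if i = j then 1 else 0)"
    by (rule dual_functions[OF frame_basis[OF Y(1,3)]]) blast
  note YT = vfield_tangent[OF frame_vfield[OF Y(1)] Y(3)]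
  have na: "smooth_near A p a" and nb: "smooth_near A p b"
    using a b smooth_near_of_smooth_on by blast+
  note Xf = vfield_smooth_near[OF X open_UNIV UNIV_I f(1)]
    and Xf' = vfield_smooth_near[OF X' open_UNIV UNIV_I f(1)]
  have br: "bracket A Z (Y i) p (f i) =
      a p * bracket A X (Y i) p (f i) - X p (f i) * Y i p a
      + b p * bracket A X' (Y i) p (f i) - X' p (f i) * Y i p b" for i
    by (simp add: bracket_apply[OF f(1)] Z(2) tv_add[OF YT] smooth_near_mult na nb Xf Xf'
      tv_mult[OF YT] algebra_simps)
  have *: "(\<Sum>i\<in>UNIV. v (f i) * Y i p g) = v g" if "v \<in> tangent_space A p" for v g
  proof -
    have "v = lincomb (\<lambda>i. v (f i)) (\<lambda>i. Y i p)"
      by (rule dual_expansion[OF frame_basis[OF Y(1,3)] f(2) that])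
    then have "v g = lincomb (\<lambda>i. v (f i)) (\<lambda>i. Y i p) g" by (rule fun_cong)
    then show ?thesis by (simp add: lincomb_def)
  qed
  have "(\<Sum>i\<in>UNIV. bracket A Z (Y i) p (f i)) =
      a p * (\<Sum>i\<in>UNIV. bracket A X (Y i) p (f i)) - X p a
      + b p * (\<Sum>i\<in>UNIV. bracket A X' (Y i) p (f i)) - X' p b"
    unfolding br sum.distrib sum_subtractf sum_distrib_left[symmetric]
    by (simp add: *[OF vfield_tangent[OF X UNIV_I]] *[OF vfield_tangent[OF X' UNIV_I]])
  then show ?thesis
    unfolding divergence_frame[OF \<omega> Z(1) Y f(2)] divergence_frame[OF \<omega> X Y f(2)]
      divergence_frame[OF \<omega> X' Y f(2)] Z(2)[of p]
    by (simp add: add_divide_distrib algebra_simps)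
qed

lemma smooth_fun_on_exp: "open W \<Longrightarrow> smooth_fun_on A W h \<Longrightarrow> smooth_fun_on A W (\<lambda>q. exp (h q))"
  by (rule smooth_fun_on_compose[OF _ open_UNIV subset_UNIV Cinf_on_exp])

text \<open>The bracket term in \<open>divergence_frame\<close> does not involve the density. The
  other term is a logarithmic derivative, to which the factor exp(h) contributes X(h).\<close>

lemma divergence_scale_density:
  assumes \<omega>: "is_density A \<omega>" and X: "vfield_on A UNIV X" and h: "smooth_fun_on A UNIV h"
    and Y: "frame_on A U Y" "open U" "p \<in> U"
  shows "divergence A (scale_density (\<lambda>q. exp (h q)) \<omega>) X p = divergence A \<omega> X p + X p h"
proof -
  obtain f where f: "\<And>j. smooth_near A p (f j)" "\<And>i j. Y i p (f j) = (if i = j then 1 else 0)"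
    by (rule dual_functions[OF frame_basis[OF Y(1,3)]]) blast
  have XT: "X p \<in> tangent_space A p" by (rule vfield_tangent[OF X UNIV_I])
  have \<omega>': "is_density A (scale_density (\<lambda>q. exp (h q)) \<omega>)"
    by (rule is_density_scale[OF \<omega> smooth_fun_on_exp[OF open_UNIV h]]) simp
  have nh: "smooth_near A p h" by (rule smooth_near_of_smooth_on[OF open_UNIV UNIV_I h])
  have ne: "smooth_near A p (\<lambda>q. exp (h q))"
    by (rule smooth_near_of_smooth_on[OF open_UNIV UNIV_I smooth_fun_on_exp[OF open_UNIV h]])
  have oY: "smooth_near A p (\<lambda>q. \<omega> q (\<lambda>i. Y i q))"
    by (rule smooth_near_of_smooth_on[OF Y(2,3) density_smooth[OF \<omega> Y(2,1)]])
  have "\<omega> p (\<lambda>i. Y i p) > 0" by (rule density_pos[OF \<omega> frame_basis[OF Y(1,3)]])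
  then show ?thesis
    unfolding divergence_frame[OF \<omega>' X Y f(2)] divergence_frame[OF \<omega> X Y f(2)]
    unfolding scale_density_def tv_mult[OF XT ne oY] tv_exp[OF XT nh]
    by (simp add: field_simps)
qed

end

section \<open>Orthonormal frames of a contact manifold\<close>

lemma sum_UNIV_option:
  fixes f :: "'k::finite option \<Rightarrow> real"
  shows "(\<Sum>i\<in>UNIV. f i) = f None + (\<Sum>i\<in>UNIV. f (Some i))"
  by (simp add: UNIV_option_conv sum.reindex)

lemma sum_UNIV_split2:
  fixes f :: "'k::finite \<Rightarrow> real"
  assumes "i \<noteq> j"
  shows "(\<Sum>k\<in>UNIV. f k) = f i + f j + (\<Sum>k\<in>UNIV - {i} - {j}. f k)"
  using assms sum.remove[of UNIV i f] sum.remove[of "UNIV - {i}" j f] by simp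

text \<open>The functions a and b play the cosine and sine of the angle; keeping them separate
  leaves the parametrisation of the circle open. The minus sign sits in the coefficient so that
  \<open>divergence_combination\<close> applies directly.\<close>

definition rotate_frame ::
    "'k \<Rightarrow> 'k \<Rightarrow> ('m \<Rightarrow> real) \<Rightarrow> ('m \<Rightarrow> real) \<Rightarrow> ('k \<Rightarrow> 'm vfield) \<Rightarrow> 'k \<Rightarrow> 'm vfield" where
  "rotate_frame i j a b X k =
    (if k = i then (\<lambda>p f. a p * X i p f + b p * X j p f)
     else if k = j then (\<lambda>p f. a p * X j p f + (- b p) * X i p f)
     else X k)"

context smooth_mfd
begin

lemma smooth_fun_on_inverse:
  "open W \<Longrightarrow> smooth_fun_on A W f \<Longrightarrow> (\<And>q. q \<in> W \<Longrightarrow> f q \<noteq> 0) \<Longrightarrow> smooth_fun_on A W (\<lambda>q. inverse (f q))"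
  by (rule smooth_fun_on_compose[OF _ _ _ Cinf_on_inverse]) auto

lemma tangent_combination:
  assumes "v \<in> tangent_space A p" "w \<in> tangent_space A p"
  shows "(\<lambda>f. a * v f + b * w f) \<in> tangent_space A p"
  using assms by (simp add: tangent_space_def algebra_simps)

lemma vfield_on_combination:
  assumes X: "vfield_on A U X" and Y: "vfield_on A U Y"
    and a: "smooth_fun_on A U a" and b: "smooth_fun_on A U b"
  shows "vfield_on A U (\<lambda>p f. a p * X p f + b p * Y p f)"
  unfolding vfield_on_def
proof (intro conjI ballI allI impI)
  fix p assume p: "p \<in> U"
  show "(\<lambda>f. a p * X p f + b p * Y p f) \<in> tangent_space A p"
    by (rule tangent_combination[OF vfield_tangent[OF X p] vfield_tangent[OF Y p]])
next
  fix V f assume V: "open V" "V \<subseteq> U" and f: "smooth_fun_on A V f"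
  show "smooth_fun_on A V (\<lambda>p. a p * X p f + b p * Y p f)"
    by (intro smooth_fun_on_add smooth_fun_on_mult V(1) smooth_fun_on_subset[OF a V(2)]
      smooth_fun_on_subset[OF b V(2)] vfield_smooth[OF X V f] vfield_smooth[OF Y V f])
qed

end

locale contact_manifold =
  fixes S :: "('m::{t2_space,second_countable_topology}, 'k::finite) subriem" and X0 :: "'m vfield"
  assumes contact: "contact_subriemannian S" and reeb: "reeb_field S X0"

sublocale contact_manifold \<subseteq> smooth_mfd "charts S"
  using contact by unfold_locales (simp add: contact_subriemannian_def)

context contact_manifold
begin

section \<open>Linear algebra of the distribution and its metric\<close>

lemma hdistr_iff: "v \<in> hdistr S p \<longleftrightarrow> v \<in> tangent_space (charts S) p \<and> cform S p v = 0"
  using contact by (simp add: contact_subriemannian_def)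

lemma cform_linear:
  assumes "v \<in> tangent_space (charts S) p" "w \<in> tangent_space (charts S) p"
  shows "cform S p (\<lambda>f. a * v f + b * w f) = a * cform S p v + b * cform S p w"
proof -
  have "is_oneform (charts S) (cform S)" using contact by (simp add: contact_subriemannian_def)
  then show ?thesis using assms by (simp add: is_oneform_def)
qed

lemma hdistr_combination:
  "v \<in> hdistr S p \<Longrightarrow> w \<in> hdistr S p \<Longrightarrow> (\<lambda>f. a * v f + b * w f) \<in> hdistr S p"
  by (simp add: hdistr_iff tangent_combination cform_linear)

lemma zero_hdistr: "(\<lambda>f. 0) \<in> hdistr S p"
  using zero_tangent cform_linear[OF zero_tangent zero_tangent, of p 0 0] by (simp add: hdistr_iff)

lemma hdistr_sum:
  "(\<And>i. i \<in> I \<Longrightarrow> v i \<in> hdistr S p) \<Longrightarrow> (\<lambda>f. \<Sum>i\<in>I. a i * v i f) \<in> hdistr S p"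
proof (induction I rule: infinite_finite_induct)
  case (insert i I)
  then show ?case
    using hdistr_combination[of "v i" p "\<lambda>f. \<Sum>i\<in>I. a i * v i f" "a i" 1] by simp
qed (simp_all add: zero_hdistr)

lemma hdistr_lincomb: "(\<And>i. v i \<in> hdistr S p) \<Longrightarrow> lincomb a v \<in> hdistr S p"
  unfolding lincomb_def by (rule hdistr_sum)

lemma scalar_product: "smooth_scalar_product S"
  using contact by (simp add: contact_subriemannian_def)

lemma hmetric_linear:
  "u \<in> hdistr S p \<Longrightarrow> v \<in> hdistr S p \<Longrightarrow> w \<in> hdistr S p \<Longrightarrow>
    hmetric S p (\<lambda>f. a * u f + b * v f) w = a * hmetric S p u w + b * hmetric S p v w"
  using scalar_product by (simp add: smooth_scalar_product_def)

lemma hmetric_sym: "u \<in> hdistr S p \<Longrightarrow> v \<in> hdistr S p \<Longrightarrow> hmetric S p u v = hmetric S p v u"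
  using scalar_product by (simp add: smooth_scalar_product_def)

lemma hmetric_pos: "v \<in> hdistr S p \<Longrightarrow> v \<noteq> (\<lambda>f. 0) \<Longrightarrow> hmetric S p v v > 0"
  using scalar_product by (simp add: smooth_scalar_product_def)

lemma hmetric_linear_right:
  "u \<in> hdistr S p \<Longrightarrow> v \<in> hdistr S p \<Longrightarrow> w \<in> hdistr S p \<Longrightarrow>
    hmetric S p w (\<lambda>f. a * u f + b * v f) = a * hmetric S p w u + b * hmetric S p w v"
  by (simp add: hmetric_sym[of w] hdistr_combination hmetric_linear)

lemma hmetric_sum:
  assumes "\<And>i. i \<in> I \<Longrightarrow> v i \<in> hdistr S p" "w \<in> hdistr S p"
  shows "hmetric S p (\<lambda>f. \<Sum>i\<in>I. a i * v i f) w = (\<Sum>i\<in>I. a i * hmetric S p (v i) w)"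
  using assms(1)
proof (induction I rule: infinite_finite_induct)
  case (insert i I)
  then show ?case
    using hmetric_linear[OF _ hdistr_sum[of I v p a] assms(2), of "v i" "a i" 1] by simp
qed (use hmetric_linear[OF assms(2,2,2), of 0 0] in simp_all)

lemma hmetric_lincomb:
  "(\<And>i. v i \<in> hdistr S p) \<Longrightarrow> w \<in> hdistr S p \<Longrightarrow>
    hmetric S p (lincomb a v) w = (\<Sum>i\<in>UNIV. a i * hmetric S p (v i) w)"
  unfolding lincomb_def by (rule hmetric_sum)

lemma orthonormal_lincomb_inject:
  assumes e: "\<And>i. e i \<in> hdistr S p" and g: "\<And>i j. hmetric S p (e i) (e j) = (if i = j then 1 else 0)"
    and eq: "lincomb a e = lincomb b e"
  shows "a = b"
proof
  fix j
  have "hmetric S p (lincomb c e) (e j) = c j" for c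
    by (simp add: hmetric_lincomb[OF e e] g if_distrib cong: if_cong)
  then show "a j = b j" using eq by metis
qed

lemma orthonormal_basisD:
  assumes "orthonormal_basis S p e"
  shows "e i \<in> hdistr S p" "hmetric S p (e i) (e j) = (if i = j then 1 else 0)"
    and "w \<in> hdistr S p \<Longrightarrow> \<exists>a. w = lincomb a e"
  using assms unfolding orthonormal_basis_def is_basis_def by blast+

lemma orthonormal_basisI:
  assumes e: "\<And>i. e i \<in> hdistr S p" and g: "\<And>i j. hmetric S p (e i) (e j) = (if i = j then 1 else 0)"
    and ex: "\<And>w. w \<in> hdistr S p \<Longrightarrow> \<exists>a. w = lincomb a e"
  shows "orthonormal_basis S p e"
  unfolding orthonormal_basis_def is_basis_def
proof (intro conjI allI ballI)
  fix w assume "w \<in> hdistr S p"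
  from ex[OF this] obtain a where "w = lincomb a e" by blast
  moreover have "b = c" if "w = lincomb b e" "w = lincomb c e" for b c
    using that by (intro orthonormal_lincomb_inject[OF e g]) simp
  ultimately show "\<exists>!a. w = lincomb a e" by blast
qed (rule e, rule g)

text \<open>The metric characterisation of the gradient: pairing it with w gives w(u), whatever the
  orthonormal basis.\<close>

lemma orthonormal_gradient:
  assumes e: "orthonormal_basis S p e" and w: "w \<in> hdistr S p"
  shows "hmetric S p (lincomb (\<lambda>i. e i u) e) w = w u"
proof -
  note eD = orthonormal_basisD(1,2)[OF e]
  obtain a where a: "w = lincomb a e" using orthonormal_basisD(3)[OF e w] by blast
  let ?W = "lincomb (\<lambda>i. e i u) e"
  have W: "?W \<in> hdistr S p" by (rule hdistr_lincomb[OF eD(1)])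
  have "hmetric S p (e i) ?W = e i u" for i
    unfolding hmetric_sym[OF eD(1) W]
    by (simp add: hmetric_lincomb[OF eD(1) eD(1)] eD(2) if_distrib cong: if_cong)
  then have "hmetric S p w ?W = w u"
    unfolding a hmetric_lincomb[OF eD(1) W] by (simp add: lincomb_def)
  then show ?thesis using hmetric_sym[OF W w] by simp
qed

text \<open>Two candidates have the same product with every horizontal vector, in particular with
  their difference D. So D has square 0 and vanishes by positivity.\<close>

lemma hgrad_eq:
  assumes e: "orthonormal_basis S p e"
  shows "hgrad S u p = lincomb (\<lambda>i. e i u) e"
  unfolding hgrad_def
proof (rule the_equality)
  show "\<forall>e'. orthonormal_basis S p e' \<longrightarrow> lincomb (\<lambda>i. e i u) e = lincomb (\<lambda>i. e' i u) e'"
  proof (intro allI impI)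
    fix e' :: "'k \<Rightarrow> 'm tvec" assume e': "orthonormal_basis S p e'"
    let ?W = "lincomb (\<lambda>i. e i u) e" and ?W' = "lincomb (\<lambda>i. e' i u) e'"
    define D where "D = (\<lambda>f. 1 * ?W f + (- 1) * ?W' f)"
    have W: "?W \<in> hdistr S p" "?W' \<in> hdistr S p"
      by (rule hdistr_lincomb[OF orthonormal_basisD(1)[OF e]], rule hdistr_lincomb[OF orthonormal_basisD(1)[OF e']])
    have D: "D \<in> hdistr S p" unfolding D_def by (rule hdistr_combination[OF W])
    have "hmetric S p D D = 0"
      using hmetric_linear[OF W D, of 1 "- 1"] unfolding D_def[symmetric]
      by (simp add: orthonormal_gradient[OF e D] orthonormal_gradient[OF e' D])
    then have "D = (\<lambda>f. 0)" using hmetric_pos[OF D] by force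
    then have "D f = 0" for f by simp
    then have "?W f = ?W' f" for f by (simp add: D_def)
    then show "?W = ?W'" by (rule ext)
  qed
qed (simp add: e)

lemma
  assumes "orthonormal_frame S X"
  shows frame_field: "vfield_on (charts S) UNIV (X i)"
    and frame_orthonormal: "orthonormal_basis S p (\<lambda>i. X i p)"
  using assms unfolding orthonormal_frame_def section_on_def by blast+

lemma hgrad_frame: "orthonormal_frame S X \<Longrightarrow> hgrad S u p f = (\<Sum>i\<in>UNIV. X i p u * X i p f)"
  unfolding hgrad_eq[OF frame_orthonormal] by (simp add: lincomb_def)

lemma hgrad_vfield:
  assumes X: "orthonormal_frame S X" and u: "smooth_fun_on (charts S) UNIV u"
  shows "vfield_on (charts S) UNIV (hgrad S u)"
  unfolding vfield_on_def
proof (intro conjI ballI allI impI)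
  show "hgrad S u p \<in> tangent_space (charts S) p" for p
    unfolding hgrad_eq[OF frame_orthonormal[OF X]]
    by (rule lincomb_tangent[OF vfield_tangent[OF frame_field[OF X] UNIV_I]])
next
  fix V f assume V: "open V" and f: "smooth_fun_on (charts S) V f"
  show "smooth_fun_on (charts S) V (\<lambda>p. hgrad S u p f)"
    unfolding hgrad_frame[OF X]
    by (intro smooth_fun_on_sum smooth_fun_on_mult V vfield_smooth[OF frame_field[OF X] V subset_UNIV]
      smooth_fun_on_subset[OF u subset_UNIV] f)
qed

section \<open>The orthonormal frame completed by the Reeb field\<close>

lemma reeb_tangent: "X0 p \<in> tangent_space (charts S) p" and cform_reeb: "cform S p (X0 p) = 1"
  and reeb_vfield: "vfield_on (charts S) UNIV X0"
  using reeb by (auto simp: reeb_field_def vfield_on_def)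

text \<open>The factor 1 gives the right-hand side the shape required by
  \<open>cform_linear\<close>.\<close>

lemma lincomb_option:
  "lincomb a (\<lambda>i. (case i of None \<Rightarrow> X0 | Some k \<Rightarrow> X k) p) =
    (\<lambda>f. a None * X0 p f + 1 * lincomb (\<lambda>i. a (Some i)) (\<lambda>i. X i p) f)"
  by (simp add: lincomb_def sum_UNIV_option)

text \<open>The contact form is 1 on \<open>X0\<close> and 0 on the distribution, so it reads off
  the coefficient at \<open>None\<close>, and w - cform(w) X0 is horizontal. This global frame is
  the one in which the divergence is computed from here on.\<close>

lemma frame_on_reeb:
  assumes X: "orthonormal_frame S X"
  shows "frame_on (charts S) UNIV (case_option X0 X)"
  unfolding frame_on_def
proof (intro conjI allI ballI)
  show V: "vfield_on (charts S) UNIV (case i of None \<Rightarrow> X0 | Some k \<Rightarrow> X k)" for i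
    by (cases i) (simp_all add: reeb_vfield frame_field[OF X])
  fix p :: 'm
  note e = frame_orthonormal[OF X, of p]
  have cf: "cform S p (lincomb a (\<lambda>i. (case i of None \<Rightarrow> X0 | Some k \<Rightarrow> X k) p)) = a None" for a
  proof -
    have "lincomb (\<lambda>i. a (Some i)) (\<lambda>i. X i p) \<in> hdistr S p"
      by (rule hdistr_lincomb[OF orthonormal_basisD(1)[OF e]])
    then have T: "lincomb (\<lambda>i. a (Some i)) (\<lambda>i. X i p) \<in> tangent_space (charts S) p"
      and "cform S p (lincomb (\<lambda>i. a (Some i)) (\<lambda>i. X i p)) = 0" unfolding hdistr_iff by auto
    then show ?thesis
      unfolding lincomb_option cform_linear[OF reeb_tangent T] by (simp add: cform_reeb)
  qed
  show "is_basis (tangent_space (charts S) p) (\<lambda>i. (case i of None \<Rightarrow> X0 | Some k \<Rightarrow> X k) p)"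
    unfolding is_basis_def
  proof (intro conjI allI ballI)
    show "(case i of None \<Rightarrow> X0 | Some k \<Rightarrow> X k) p \<in> tangent_space (charts S) p" for i
      by (rule vfield_tangent[OF V UNIV_I])
    fix w assume w: "w \<in> tangent_space (charts S) p"
    define w' where "w' = (\<lambda>f. 1 * w f + (- cform S p w) * X0 p f)"
    have "w' \<in> hdistr S p"
      unfolding w'_def hdistr_iff
      by (simp only: tangent_combination[OF w reeb_tangent] cform_linear[OF w reeb_tangent] cform_reeb) simp
    then obtain a where a: "w' = lincomb a (\<lambda>i. X i p)" using orthonormal_basisD(3)[OF e] by blast
    have "w f = cform S p w * X0 p f + 1 * w' f" for f by (simp add: w'_def)
    then have "w = lincomb (case_option (cform S p w) a) (\<lambda>i. (case i of None \<Rightarrow> X0 | Some k \<Rightarrow> X k) p)"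
      unfolding lincomb_option a by (intro ext) simp
    moreover have "b = c" if b: "w = lincomb b (\<lambda>i. (case i of None \<Rightarrow> X0 | Some k \<Rightarrow> X k) p)"
      and c: "w = lincomb c (\<lambda>i. (case i of None \<Rightarrow> X0 | Some k \<Rightarrow> X k) p)" for b c
    proof -
      have N: "b None = c None" using cf[of b] cf[of c] b c by simp
      have "lincomb (\<lambda>i. b (Some i)) (\<lambda>i. X i p) f = lincomb (\<lambda>i. c (Some i)) (\<lambda>i. X i p) f" for f
        using fun_cong[OF trans[OF b[symmetric] c], of f] unfolding lincomb_option N by simp
      then have eq: "lincomb (\<lambda>i. b (Some i)) (\<lambda>i. X i p) = lincomb (\<lambda>i. c (Some i)) (\<lambda>i. X i p)" by (rule ext)
      have "(\<lambda>i. b (Some i)) = (\<lambda>i. c (Some i))"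
        by (rule orthonormal_lincomb_inject[OF orthonormal_basisD(1,2)[OF e] eq])
      then have "b i = c i" for i using N by (cases i) (auto dest: fun_cong)
      then show ?thesis by (rule ext)
    qed
    ultimately show "\<exists>!a. w = lincomb a (\<lambda>i. (case i of None \<Rightarrow> X0 | Some k \<Rightarrow> X k) p)" by blast
  qed
qed

lemma orthonormal_frame_rotate:
  assumes X: "orthonormal_frame S X" and ij: "i \<noteq> j"
    and a: "smooth_fun_on (charts S) UNIV a" and b: "smooth_fun_on (charts S) UNIV b"
    and ab: "\<And>p. a p * a p + b p * b p = 1"
  shows "orthonormal_frame S (rotate_frame i j a b X)"
proof -
  have mb: "smooth_fun_on (charts S) UNIV (\<lambda>p. - b p)"
    using smooth_fun_on_mult[OF open_UNIV smooth_fun_on_const[OF open_UNIV, of "- 1"] b] by simp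
  let ?Y = "rotate_frame i j a b X"
  note Y = rotate_frame_def[of i j a b X]
  have V: "vfield_on (charts S) UNIV (?Y k)" for k
    unfolding Y by (simp add: vfield_on_combination[OF frame_field[OF X] frame_field[OF X] a b, simplified]
      vfield_on_combination[OF frame_field[OF X] frame_field[OF X] a mb, simplified] frame_field[OF X])
  have basis: "orthonormal_basis S p (\<lambda>k. ?Y k p)" for p
  proof (rule orthonormal_basisI)
    note e = orthonormal_basisD[OF frame_orthonormal[OF X, of p]]
    show "?Y k p \<in> hdistr S p" for k
      unfolding Y by (simp only: hdistr_combination[OF e(1) e(1)] e(1) split: if_split) simp
    show "hmetric S p (?Y k p) (?Y l p) = (if k = l then 1 else 0)" for k l
      using ij ab[of p] unfolding Y
      by (cases "k = i"; cases "k = j"; cases "l = i"; cases "l = j")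
        (simp_all only: if_True if_False hmetric_linear hmetric_linear_right e hdistr_combination
          refl simp_thms, auto simp: algebra_simps)
    fix w assume "w \<in> hdistr S p"
    then obtain c where c: "w = lincomb c (\<lambda>k. X k p)" using e(3) by blast
    \<comment> \<open>The scalar products of w with the rotated fields, that is, the coefficients of
      w rotated by the same angle.\<close>
    define c' where "c' k = (if k = i then a p * c i + b p * c j
      else if k = j then a p * c j - b p * c i else c k)" for k
    have "w f = lincomb c' (\<lambda>k. ?Y k p) f" for f
    proof -
      have "c i * X i p f + c j * X j p f = (a p * a p + b p * b p) * (c i * X i p f + c j * X j p f)"
        by (simp add: ab)
      also have "\<dots> = c' i * ?Y i p f + c' j * ?Y j p f"
        using ij by (simp add: c'_def Y algebra_simps)
      finally have "c i * X i p f + c j * X j p f = c' i * ?Y i p f + c' j * ?Y j p f" .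
      moreover have "(\<Sum>k\<in>UNIV - {i} - {j}. c k * X k p f) = (\<Sum>k\<in>UNIV - {i} - {j}. c' k * ?Y k p f)"
        by (rule sum.cong) (auto simp: c'_def Y)
      ultimately show ?thesis
        unfolding c lincomb_def sum_UNIV_split2[OF ij] by simp
    qed
    then show "\<exists>c. w = lincomb c (\<lambda>k. ?Y k p)" by blast
  qed
  show ?thesis
    unfolding orthonormal_frame_def section_on_def using V basis orthonormal_basisD(1)[OF basis] by blast
qed

end

section \<open>Dependence of the limit operator on the frame\<close>

context contact_manifold
begin

text \<open>With \<open>t(p) = 0\<close>, the rotation by \<open>a = (1 - t\<^sup>2)/(1 + t\<^sup>2)\<close>, \<open>b = 2t/(1 + t\<^sup>2)\<close> is the identity at \<open>p\<close>,
  with \<open>da = 0\<close> and \<open>db = 2dt\<close> there. It changes \<open>\<Sum> div(X\<^sub>k)X\<^sub>k\<close> by \<open>2(X\<^sub>j(t)X\<^sub>i - X\<^sub>i(t)X\<^sub>j)\<close> at \<open>p\<close>.\<close>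
lemma rotation_changes_drift:
  fixes i j :: 'k
  assumes \<omega>: "is_density (charts S) \<omega>" and X: "orthonormal_frame S X" and ij: "i \<noteq> j"
  obtains Y u where "orthonormal_frame S Y" "smooth_fun_on (charts S) UNIV u"
    "(\<Sum>k\<in>UNIV. divergence (charts S) \<omega> (X k) p * X k p u) =
      (\<Sum>k\<in>UNIV. divergence (charts S) \<omega> (Y k) p * Y k p u) + 2"
proof -
  let ?A = "charts S"
  note F = frame_on_reeb[OF X]
  note XT = vfield_tangent[OF frame_field[OF X] UNIV_I]
  have gl: "smooth_near ?A q g" if "smooth_fun_on ?A UNIV g" for q g
    by (rule smooth_near_of_smooth_on[OF open_UNIV UNIV_I that])
  obtain f where f: "\<And>l. smooth_near ?A p (f l)"
    "\<And>k l. (case k of None \<Rightarrow> X0 | Some k \<Rightarrow> X k) p (f l) = (if k = l then 1 else 0)"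
    by (rule dual_functions[OF frame_basis[OF F UNIV_I]]) blast
  have Xf: "X k p (f (Some l)) = (if k = l then 1 else 0)" for k l using f(2)[of "Some k" "Some l"] by simp
  \<comment> \<open>The rotation must be smooth on all of M, so the dual functions, known only near
    p, give way to global functions with the same derivatives at p. The value t(p) = 0 makes the
    rotation trivial at p.\<close>
  obtain t where t: "smooth_fun_on ?A UNIV t" "t p = 0"
    "\<And>v. v \<in> tangent_space ?A p \<Longrightarrow> v t = v (f (Some i))"
    by (rule smooth_near_extend[OF f(1)]) blast
  obtain u where u: "smooth_fun_on ?A UNIV u" "u p = 0"
    "\<And>v. v \<in> tangent_space ?A p \<Longrightarrow> v u = v (f (Some j))"
    by (rule smooth_near_extend[OF f(1)]) blast
  have Xt: "X k p t = (if k = i then 1 else 0)" and Xu: "X k p u = (if k = j then 1 else 0)" for k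
    by (simp_all add: t(3)[OF XT] u(3)[OF XT] Xf)

  define s where "s = (\<lambda>q. inverse (1 + t q * t q))"
  have pos: "1 + t q * t q > 0" for q by (rule add_pos_nonneg) simp_all
  have s_smooth: "smooth_fun_on ?A UNIV s"
    unfolding s_def
    by (intro smooth_fun_on_inverse smooth_fun_on_add smooth_fun_on_mult smooth_fun_on_const t(1) open_UNIV)
      (use pos in \<open>simp add: less_imp_neq[symmetric]\<close>)
  define a where "a = (\<lambda>q. (1 + (- 1) * (t q * t q)) * s q)"
  define b where "b = (\<lambda>q. 2 * (t q * s q))"
  have a: "smooth_fun_on ?A UNIV a" and b: "smooth_fun_on ?A UNIV b"
    unfolding a_def b_def
    by (intro smooth_fun_on_add smooth_fun_on_mult smooth_fun_on_const t(1) s_smooth open_UNIV)+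
  have mb: "smooth_fun_on ?A UNIV (\<lambda>q. - b q)"
    using smooth_fun_on_mult[OF open_UNIV smooth_fun_on_const[OF open_UNIV, of "- 1"] b] by simp
  have ab: "a q * a q + b q * b q = 1" for q
  proof -
    have "s q * (1 + t q * t q) = 1" using pos[of q] by (simp add: s_def)
    moreover have "a q * a q + b q * b q = (s q * (1 + t q * t q)) * (s q * (1 + t q * t q))"
      by (simp add: a_def b_def algebra_simps)
    ultimately show ?thesis by simp
  qed
  have ap: "a p = 1" and bp: "b p = 0" and sp: "s p = 1" by (simp_all add: a_def b_def s_def t(2))
  \<comment> \<open>Since t(p) = 0 and s(p) = 1, the derivative of s drops out of the Leibniz
    rule.\<close>
  have vb: "v b = 2 * v t" if v: "v \<in> tangent_space ?A p" for v
    unfolding b_def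
    by (simp add: tv_cmult[OF v smooth_near_mult] tv_mult[OF v] gl t(1,2) s_smooth sp)
  \<comment> \<open>The derivative of a is read off from a^2 + b^2 = 1, differentiated at p where a
    = 1 and b = 0.\<close>
  have va: "v a = 0" if v: "v \<in> tangent_space ?A p" for v
  proof -
    have "v (\<lambda>q. a q * a q + b q * b q) = 2 * v a"
      by (simp add: tv_add[OF v] tv_mult[OF v] smooth_near_mult gl a b ap bp)
    then show ?thesis unfolding ab by (simp add: tv_const[OF v])
  qed
  have vmb: "v (\<lambda>q. - b q) = - 2 * v t" if v: "v \<in> tangent_space ?A p" for v
    using tv_cmult[OF v gl[OF b], of "- 1"] vb[OF v] by simp

  let ?Y = "rotate_frame i j a b X"
  have Y: "orthonormal_frame S ?Y" by (rule orthonormal_frame_rotate[OF X ij a b ab])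
  note FX = frame_field[OF X] and FY = frame_field[OF Y]
  \<comment> \<open>The j-th rotated field is a X_j - b X_i, so the Leibniz rule adds X_j(a) -
    X_i(b) = -2 X_i(t) = -2 at p. Since u is dual to X_j there, the divergence of the i-th rotated
    field is multiplied by 0 in the sum.\<close>
  have "divergence ?A \<omega> (?Y j) p = divergence ?A \<omega> (X j) p - 2"
    using divergence_combination[OF \<omega> FX[of j] FX[of i] a mb FY[of j] _ F open_UNIV UNIV_I, of p] ij
    by (simp add: rotate_frame_def va[OF XT] vmb[OF XT] ap bp Xt)
  moreover have "?Y i p u = 0" "?Y j p u = 1" "?Y k p = X k p" for k
    using ij by (simp_all add: rotate_frame_def ap bp Xu)
  moreover have "?Y k = X k" if "k \<noteq> i" "k \<noteq> j" for k using that by (simp add: rotate_frame_def)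
  ultimately have "(\<Sum>k\<in>UNIV. divergence ?A \<omega> (X k) p * X k p u) =
      (\<Sum>k\<in>UNIV. divergence ?A \<omega> (?Y k) p * ?Y k p u) + 2"
    unfolding sum_UNIV_split2[OF ij] using ij by (simp add: Xu)
  with Y u(1) show ?thesis by (rule that)
qed

text \<open>Changing the density adds grad(u) applied to h, which equals grad(h) applied to u by
  symmetry of the sum of X_i(u) X_i(h).\<close>

lemma sublaplacian_scale_density:
  assumes \<omega>: "is_density (charts S) \<omega>" and X: "orthonormal_frame S X"
    and h: "smooth_fun_on (charts S) UNIV h" and u: "smooth_fun_on (charts S) UNIV u"
  shows "sublaplacian S (scale_density (\<lambda>p. exp (h p)) \<omega>) u p = sublaplacian S \<omega> u p + hgrad S h p u"
proof -
  have "hgrad S u p h = hgrad S h p u" unfolding hgrad_frame[OF X] by (simp add: mult.commute)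
  then show ?thesis
    unfolding sublaplacian_def
    by (simp add: divergence_scale_density[OF \<omega> hgrad_vfield[OF X u] h frame_on_reeb[OF X] open_UNIV UNIV_I])
qed

end

theorem corollary25:
  fixes S :: "('m::{t2_space,second_countable_topology}, 'k::finite) subriem"
    and X0 :: "'m vfield"
    and P \<omega> :: "('m, 'k option) density"
    and h :: "'m \<Rightarrow> real"
    and c :: real
    and d :: nat
  assumes "d \<ge> 1" and "CARD('k) = 2 * d"
    and "contact_subriemannian S"
    and "sr_complete S"
    and "\<exists>X. orthonormal_frame S X"
    and "reeb_field S X0"
    and "popp_density S X0 P"
    and "smooth_fun_on (charts S) UNIV h"
    and "\<omega> = scale_density (\<lambda>p. exp (h p)) P"
    and "0 \<le> c" and "c \<le> 1"
  shows "((\<forall>X Y. orthonormal_frame S X \<longrightarrow> orthonormal_frame S Y \<longrightarrow>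
            (\<forall>u. smooth_fun_on (charts S) UNIV u \<longrightarrow>
               limit_operator S \<omega> h c X u = limit_operator S \<omega> h c Y u))
          \<longleftrightarrow> c = 1) \<and>
         (\<forall>X u. orthonormal_frame S X \<longrightarrow> smooth_fun_on (charts S) UNIV u \<longrightarrow>
            limit_operator S \<omega> h 1 X u = (\<lambda>p. sublaplacian S \<omega> u p + hgrad S h p u) \<and>
            (\<lambda>p. sublaplacian S \<omega> u p + hgrad S h p u)
              = sublaplacian S (scale_density (\<lambda>p. exp (h p)) \<omega>) u \<and>
            sublaplacian S (scale_density (\<lambda>p. exp (h p)) \<omega>) u
              = sublaplacian S (scale_density (\<lambda>p. exp (2 * h p)) P) u)"
proof -
  interpret contact_manifold S X0 using assms(3,6) by unfold_locales
  note h = assms(8)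
  have \<omega>: "is_density (charts S) \<omega>"
    unfolding assms(9) using assms(7)
    by (intro is_density_scale smooth_fun_on_exp[OF open_UNIV h]) (simp_all add: popp_density_def)
  have imp: "c = 1" if ind: "\<forall>X Y. orthonormal_frame S X \<longrightarrow> orthonormal_frame S Y \<longrightarrow>
      (\<forall>u. smooth_fun_on (charts S) UNIV u \<longrightarrow> limit_operator S \<omega> h c X u = limit_operator S \<omega> h c Y u)"
  proof -
    obtain X where X: "orthonormal_frame S X" using assms(5) by blast
    \<comment> \<open>The rank 2d is at least 2, which provides two distinct indices to
      rotate.\<close>
    have "\<not> card (UNIV :: 'k set) \<le> Suc 0" using assms(1,2) by simp
    then obtain i j :: 'k where ij: "i \<noteq> j" using card_le_Suc0_iff_eq[of "UNIV :: 'k set"] by auto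
    fix p :: 'm
    obtain Y u where Y: "orthonormal_frame S Y" "smooth_fun_on (charts S) UNIV u"
      and diff: "(\<Sum>k\<in>UNIV. divergence (charts S) \<omega> (X k) p * X k p u) =
        (\<Sum>k\<in>UNIV. divergence (charts S) \<omega> (Y k) p * Y k p u) + 2"
      by (rule rotation_changes_drift[OF \<omega> X ij])
    have "limit_operator S \<omega> h c X u p = limit_operator S \<omega> h c Y u p"
      by (rule fun_cong[OF ind[rule_format, OF X Y]])
    \<comment> \<open>The terms that do not mention the frame cancel, as do the common parts of the
      drifts, leaving 2(c - 1) = 0.\<close>
    then show ?thesis unfolding limit_operator_def diff by (simp add: algebra_simps)
  qed
  have lim: "limit_operator S \<omega> h 1 X u = (\<lambda>p. sublaplacian S \<omega> u p + hgrad S h p u)" for X u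
    unfolding limit_operator_def by (rule ext) simp
  have scale: "scale_density (\<lambda>p. exp (h p)) \<omega> = scale_density (\<lambda>p. exp (2 * h p)) P"
    unfolding assms(9) scale_density_def by (intro ext) (simp add: exp_double power2_eq_square)
  have lap: "(\<lambda>p. sublaplacian S \<omega> u p + hgrad S h p u) = sublaplacian S (scale_density (\<lambda>p. exp (h p)) \<omega>) u"
    if "orthonormal_frame S X" "smooth_fun_on (charts S) UNIV u" for X u
    by (rule ext) (rule sublaplacian_scale_density[OF \<omega> that(1) h that(2), symmetric])
  show ?thesis
  proof (rule conjI[OF iffI])
    assume "c = 1"
    then show "\<forall>X Y. orthonormal_frame S X \<longrightarrow> orthonormal_frame S Y \<longrightarrow> (\<forall>u. smooth_fun_on (charts S) UNIV u \<longrightarrow>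
        limit_operator S \<omega> h c X u = limit_operator S \<omega> h c Y u)"
      by (simp only: lim refl simp_thms)
  qed (rule imp, assumption, intro conjI allI impI lim lap, assumption+, simp only: scale)
qed

end
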